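(* Let $L$ be a locally finite-dimensional restricted Lie algebra over a perfect field $\mathbb{F}$ of characteristic $p>0$. If the restricted enveloping algebra $u(L)$ is semiperfect and the derived subalgebra $L'$ is $p$-nil, then $\mathcal{O}_p(L)$ has finite codimension in $L$.
   Context: For a ring $R$ with unity, $\mathcal{J}(R)$ denotes its Jacobson radical. $R$ is semiperfect if $R/\mathcal{J}(R)$ is Artinian and idempotents of $R/\mathcal{J}(R)$ can be lifted to $R$. A field is perfect if every finite extension of it is separable. For a restricted Lie algebra $L$ with $p$-map $x\mapsto x^{[p]}$, $u(L)$ denotes its restricted enveloping algebra and $L'=[L,L]$ its derived subalgebra. $L$ is locally finite-dimensional if all of its finitely generated restricted subalgebras are finite-dimensional. An element $x\in L$ is $p$-nilpotent if $x^{[p]^n}=0$ for some $n\geq 1$, where $x^{[p]^n}$ is the $n$-fold iterate of the $p$-map applied to $x$. A subset of $L$ is $p$-nil if each of its elements is $p$-nilpotent. A restricted ideal is a Lie ideal closed under the $p$-map. $\mathcal{O}_p(L)$ denotes the sum of all $p$-nil restricted ideals of $L$; it is itself a $p$-nil restricted ideal. *)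

theory Defs
  imports "HOL-Algebra.Algebraic_Closure_Type" "HOL-Library.Poly_Mapping"
begin

section \<open>Perfect fields\<close>

text \<open>
  Every finite extension of a field embeds over that field into its algebraic closure, so
  the finite extensions are taken to be the intermediate fields of the algebraic closure.
\<close>

definition finite_extension :: "'k::field alg_closure set \<Rightarrow> bool" where
  "finite_extension K \<longleftrightarrow>
     subfield K ring_of_type_algebra \<and> range to_ac \<subseteq> K \<and>
     ring.finite_dimension ring_of_type_algebra (range (to_ac :: 'k \<Rightarrow> 'k alg_closure)) K"

text \<open>
  An element is separable if its minimal polynomial (the monic irreducible polynomial over
  the ground field that vanishes there) has only simple roots in the algebraic closure.
\<close>

definition separable_element :: "'k::field alg_closure \<Rightarrow> bool" where
  "separable_element x \<longleftrightarrow>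
     (\<exists>f :: 'k poly. lead_coeff f = 1 \<and> irreducible f \<and>
        poly (map_poly to_ac f) x = 0 \<and> rsquarefree (map_poly to_ac f))"

definition perfect_field :: "'k::field itself \<Rightarrow> bool" where
  "perfect_field _ \<longleftrightarrow>
     (\<forall>K :: 'k alg_closure set. finite_extension K \<longrightarrow> (\<forall>x\<in>K. separable_element x))"


section \<open>Semiperfect rings\<close>

definition left_ideal :: "'a set \<Rightarrow> ('a, 'b) ring_scheme \<Rightarrow> bool" where
  "left_ideal I R \<longleftrightarrow>
     additive_subgroup I R \<and> (\<forall>r\<in>carrier R. \<forall>x\<in>I. r \<otimes>\<^bsub>R\<^esub> x \<in> I)"

definition right_ideal :: "'a set \<Rightarrow> ('a, 'b) ring_scheme \<Rightarrow> bool" where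
  "right_ideal I R \<longleftrightarrow>
     additive_subgroup I R \<and> (\<forall>r\<in>carrier R. \<forall>x\<in>I. x \<otimes>\<^bsub>R\<^esub> r \<in> I)"

definition maximal_left_ideal :: "'a set \<Rightarrow> ('a, 'b) ring_scheme \<Rightarrow> bool" where
  "maximal_left_ideal M R \<longleftrightarrow>
     left_ideal M R \<and> M \<noteq> carrier R \<and>
     (\<forall>I. left_ideal I R \<and> M \<subseteq> I \<longrightarrow> I = M \<or> I = carrier R)"

definition jacobson_radical :: "('a, 'b) ring_scheme \<Rightarrow> 'a set" where
  "jacobson_radical R = {x \<in> carrier R. \<forall>M. maximal_left_ideal M R \<longrightarrow> x \<in> M}"

definition left_artinian :: "('a, 'b) ring_scheme \<Rightarrow> bool" where
  "left_artinian R \<longleftrightarrow>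
     (\<forall>I :: nat \<Rightarrow> 'a set. (\<forall>n. left_ideal (I n) R) \<and> (\<forall>n. I (Suc n) \<subseteq> I n) \<longrightarrow>
        (\<exists>N. \<forall>n\<ge>N. I n = I N))"

definition right_artinian :: "('a, 'b) ring_scheme \<Rightarrow> bool" where
  "right_artinian R \<longleftrightarrow>
     (\<forall>I :: nat \<Rightarrow> 'a set. (\<forall>n. right_ideal (I n) R) \<and> (\<forall>n. I (Suc n) \<subseteq> I n) \<longrightarrow>
        (\<exists>N. \<forall>n\<ge>N. I n = I N))"

text \<open>
  For the quotient by the Jacobson radical, the left and the right Artinian condition are
  equivalent to each other.
\<close>

definition artinian :: "('a, 'b) ring_scheme \<Rightarrow> bool" where
  "artinian R \<longleftrightarrow> left_artinian R \<and> right_artinian R"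

definition idempotent_in :: "('a, 'b) ring_scheme \<Rightarrow> 'a \<Rightarrow> bool" where
  "idempotent_in R e \<longleftrightarrow> e \<in> carrier R \<and> e \<otimes>\<^bsub>R\<^esub> e = e"

definition idempotents_lift :: "('a, 'b) ring_scheme \<Rightarrow> 'a set \<Rightarrow> bool" where
  "idempotents_lift R I \<longleftrightarrow>
     (\<forall>E. idempotent_in (R Quot I) E \<longrightarrow> (\<exists>e. idempotent_in R e \<and> I +>\<^bsub>R\<^esub> e = E))"

definition semiperfect :: "('a, 'b) ring_scheme \<Rightarrow> bool" where
  "semiperfect R \<longleftrightarrow>
     ring R \<and> artinian (R Quot jacobson_radical R) \<and>
     idempotents_lift R (jacobson_radical R)"


section \<open>Free associative algebras\<close>

text \<open>
  Words under concatenation form the free monoid, written additively because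
  \<^typ>\<open>'a \<Rightarrow>\<^sub>0 'b\<close> takes its convolution product from an additive monoid of exponents. Thus
  \<open>'a free_word \<Rightarrow>\<^sub>0 'k\<close> is the free associative unital algebra over \<open>'k\<close> on the set \<open>'a\<close>.
\<close>

datatype 'a free_word = Word (letters: "'a list")

instantiation free_word :: (type) monoid_add
begin

definition zero_free_word :: "'a free_word" where
  "0 = Word []"

definition plus_free_word :: "'a free_word \<Rightarrow> 'a free_word \<Rightarrow> 'a free_word" where
  "v + w = Word (letters v @ letters w)"

instance
  by standard (simp_all add: zero_free_word_def plus_free_word_def)

end

definition free_gen :: "'a \<Rightarrow> 'a free_word \<Rightarrow>\<^sub>0 'k::field" where
  "free_gen x = Poly_Mapping.single (Word [x]) 1"

definition free_const :: "'k::field \<Rightarrow> 'a free_word \<Rightarrow>\<^sub>0 'k" where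
  "free_const c = Poly_Mapping.single 0 c"

lemma (in ring_1) ring_ring_of_type_algebra: "ring (ring_of_type_algebra :: 'a ring)"
proof -
  have "\<exists>y. x + y = 0" for x :: 'a
    using add.right_inverse by blast
  thus ?thesis
    unfolding ring_of_type_algebra_def using add.right_inverse
    by unfold_locales (auto simp: algebra_simps Units_def)
qed


section \<open>Restricted Lie algebras\<close>

locale lie_algebra = vector_space scale
  for scale :: "'k::field \<Rightarrow> 'l::ab_group_add \<Rightarrow> 'l" +
  fixes bracket :: "'l \<Rightarrow> 'l \<Rightarrow> 'l"
  assumes bracket_add_left: "bracket (x + y) z = bracket x z + bracket y z"
    and bracket_add_right: "bracket x (y + z) = bracket x y + bracket x z"
    and bracket_scale_left: "bracket (scale c x) y = scale c (bracket x y)"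
    and bracket_scale_right: "bracket x (scale c y) = scale c (bracket x y)"
    and bracket_self: "bracket x x = 0"
    and jacobi:
      "bracket x (bracket y z) + bracket y (bracket z x) + bracket z (bracket x y) = 0"
begin

text \<open>The map \<open>ad (t x + y)\<close> on polynomials in \<open>t\<close> with coefficients in the Lie algebra.\<close>

definition ad_poly :: "'l \<Rightarrow> 'l \<Rightarrow> 'l poly \<Rightarrow> 'l poly" where
  "ad_poly x y f = pCons 0 (map_poly (bracket x) f) + map_poly (bracket y) f"

text \<open>
  Jacobson's terms \<open>s\<^sub>i(x, y)\<close>, \<open>0 < i < p\<close>: the product \<open>i s\<^sub>i(x, y)\<close> is the coefficient of
  \<open>t\<^sup>i\<^sup>-\<^sup>1\<close> in \<open>ad (t x + y)\<^sup>p\<^sup>-\<^sup>1 (x)\<close>.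
\<close>

definition jacobson_term :: "nat \<Rightarrow> 'l \<Rightarrow> 'l \<Rightarrow> 'l" where
  "jacobson_term i x y =
     scale (inverse (of_nat i)) (coeff ((ad_poly x y ^^ (CHAR('k) - 1)) [:x:]) (i - 1))"

definition derived_subalgebra :: "'l set" where
  "derived_subalgebra = span {bracket x y | x y. True}"

end

locale restricted_lie_algebra = lie_algebra scale bracket
  for scale :: "'k::field \<Rightarrow> 'l::ab_group_add \<Rightarrow> 'l" and bracket :: "'l \<Rightarrow> 'l \<Rightarrow> 'l" +
  fixes pmap :: "'l \<Rightarrow> 'l"
  assumes char_pos: "CHAR('k) > 0"
    and pmap_scale: "pmap (scale c x) = scale (c ^ CHAR('k)) (pmap x)"
    and bracket_pmap: "bracket (pmap x) y = (bracket x ^^ CHAR('k)) y"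
    and pmap_add:
      "pmap (x + y) = pmap x + pmap y + (\<Sum>i\<in>{1..<CHAR('k)}. jacobson_term i x y)"
begin

definition restricted_subalgebra :: "'l set \<Rightarrow> bool" where
  "restricted_subalgebra S \<longleftrightarrow>
     subspace S \<and> (\<forall>x\<in>S. \<forall>y\<in>S. bracket x y \<in> S) \<and> (\<forall>x\<in>S. pmap x \<in> S)"

definition restricted_ideal :: "'l set \<Rightarrow> bool" where
  "restricted_ideal I \<longleftrightarrow>
     subspace I \<and> (\<forall>x. \<forall>y\<in>I. bracket x y \<in> I) \<and> (\<forall>x\<in>I. pmap x \<in> I)"

definition finite_dimensional :: "'l set \<Rightarrow> bool" where
  "finite_dimensional S \<longleftrightarrow> (\<exists>B. finite B \<and> span B = S)"

text \<open>Finitely many cosets of \<open>S\<close>, those of the elements of \<open>B\<close>, span the quotient by \<open>S\<close>.\<close>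

definition finite_codimension :: "'l set \<Rightarrow> bool" where
  "finite_codimension S \<longleftrightarrow>
     subspace S \<and> (\<exists>B. finite B \<and> (\<forall>x. \<exists>y\<in>span B. x - y \<in> S))"

definition locally_finite_dimensional :: bool where
  "locally_finite_dimensional \<longleftrightarrow>
     (\<forall>A. finite A \<longrightarrow> finite_dimensional (restricted_subalgebra hull A))"

definition p_nilpotent :: "'l \<Rightarrow> bool" where
  "p_nilpotent x \<longleftrightarrow> (\<exists>n\<ge>1. (pmap ^^ n) x = 0)"

definition p_nil :: "'l set \<Rightarrow> bool" where
  "p_nil S \<longleftrightarrow> (\<forall>x\<in>S. p_nilpotent x)"

definition O_p :: "'l set" where
  "O_p = span (\<Union>{I. restricted_ideal I \<and> p_nil I})"

text \<open>
  The restricted enveloping algebra is presented by the generators \<open>x \<in> L\<close>. The first two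
  families of relations make the generator map linear, so that they present the tensor
  algebra of \<open>L\<close>; the third family presents the universal enveloping algebra, and the last
  identifies the \<open>p\<close>-map with the \<open>p\<close>-th power.
\<close>

definition enveloping_relations :: "('l free_word \<Rightarrow>\<^sub>0 'k) set" where
  "enveloping_relations =
     {free_gen (x + y) - free_gen x - free_gen y | x y. True} \<union>
     {free_gen (scale c x) - free_const c * free_gen x | c x. True} \<union>
     {free_gen x * free_gen y - free_gen y * free_gen x - free_gen (bracket x y) | x y. True} \<union>
     {free_gen x ^ CHAR('k) - free_gen (pmap x) | x. True}"

definition restricted_enveloping_algebra :: "('l free_word \<Rightarrow>\<^sub>0 'k) set ring" where
  "restricted_enveloping_algebra =
     ring_of_type_algebra Quot (genideal ring_of_type_algebra enveloping_relations)"

lemma ring_restricted_enveloping_algebra: "ring restricted_enveloping_algebra"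
proof -
  have "ideal (genideal ring_of_type_algebra enveloping_relations)
          (ring_of_type_algebra :: ('l free_word \<Rightarrow>\<^sub>0 'k) ring)"
    by (rule ring.genideal_ideal[OF ring_ring_of_type_algebra])
      (simp add: ring_of_type_algebra_def)
  thus ?thesis
    unfolding restricted_enveloping_algebra_def by (rule ideal.quotient_is_ring)
qed

end

end

theory Submission
  imports Defs
begin

text \<open>
  Let \<open>F\<close> denote the \<open>p\<close>-map and \<open>P\<close> the set of \<open>p\<close>-nilpotent elements of \<open>L\<close>. Since \<open>L'\<close> is
  \<open>p\<close>-nil and \<open>L\<close> is locally finite-dimensional, an Engel argument shows that \<open>P\<close> is a restricted ideal
  (\<open>restricted_ideal_p_nilpotents\<close>). It is then contained in \<open>O_p\<close>, so it is enough that \<open>P\<close> has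
  finite codimension. The quotient \<open>L / P\<close> is an abelian restricted Lie algebra on which \<open>F\<close> is injective
  and semilinear, and over a perfect field each of its elements is a linear combination of its own images under
  the positive powers of \<open>F\<close> (\<open>pmap_radical_relation\<close>): it behaves like a torus.

  A torus is detected by characters, the linear maps \<open>\<phi>\<close> from \<open>L\<close> to the algebraic closure that
  kill brackets and satisfy \<open>\<phi>(F x) = \<phi>(x)\<^sup>p\<close>. There are enough of them to separate points from
  restricted ideals containing \<open>P\<close> (\<open>exists_character\<close>), which replaces any use of the
  Poincare-Birkhoff-Witt theorem. Each extends to a homomorphism from \<open>u(L)\<close> to a field of algebraic
  elements, and its kernel is a maximal left ideal (\<open>maximal_left_ideal_free_eval_kernel\<close>). On the
  other hand, for each \<open>x\<close> there is an element of \<open>u(L)\<close> on which a character takes the value \<open>0\<close> or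
  \<open>1\<close> according to whether it kills \<open>x\<close> (\<open>exists_support_idempotent\<close>).

  If \<open>L / P\<close> had infinite dimension, there would be an infinite sequence of elements, each separated by a
  character from its predecessors. The products of the complements of the corresponding idempotents show
  that the associated intersections of maximal left ideals form a strictly decreasing chain, so
  \<open>u(L)\<close> modulo its radical would fail to be Artinian (\<open>finite_codimension_p_nilpotents\<close>).
\<close>

section \<open>Perfect fields and additive polynomials\<close>

lemma map_poly_to_ac_mult: "map_poly to_ac (f * g) = map_poly to_ac f * map_poly to_ac g"
  by (rule poly_eqI) (simp add: coeff_map_poly coeff_mult to_ac_sum)

lemma map_poly_to_ac_add: "map_poly to_ac (f + g) = map_poly to_ac f + map_poly to_ac g"
  by (rule poly_eqI) (simp add: coeff_map_poly)

lemma exists_minimal_polynomial: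
  fixes x :: "'k::field alg_closure"
  obtains g :: "'k poly" where "g \<noteq> 0" "poly (map_poly to_ac g) x = 0"
    "\<And>h. poly (map_poly to_ac h) x = 0 \<Longrightarrow> g dvd h"
proof -
  let ?P = "\<lambda>g :: 'k poly. g \<noteq> 0 \<and> poly (map_poly to_ac g) x = 0"
  obtain g0 where "?P g0"
    using alg_closure_algebraic[of x] by metis
  then obtain g where g: "?P g" and min: "\<And>h. ?P h \<Longrightarrow> degree g \<le> degree h"
    using ex_has_least_nat[of ?P g0 degree] by blast
  have "g dvd h" if h: "poly (map_poly to_ac h) x = 0" for h
  proof -
    have "map_poly to_ac h = map_poly to_ac (h div g) * map_poly to_ac g + map_poly to_ac (h mod g)"
      by (simp flip: map_poly_to_ac_mult map_poly_to_ac_add)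
    hence "poly (map_poly to_ac (h mod g)) x = 0"
      using h g by simp
    hence "h mod g = 0"
      using min[of "h mod g"] degree_mod_less[of g h] g by (meson leD)
    thus ?thesis by auto
  qed
  with g that show ?thesis by blast
qed

lemma subfield_range_to_ac:
  "subfield (range (to_ac :: 'k::field \<Rightarrow> 'k alg_closure)) ring_of_type_algebra"
proof -
  let ?L = "ring_of_type_algebra :: 'k alg_closure ring"
  interpret L: field ?L by (rule field_from_type_algebra)
  have neg: "\<ominus>\<^bsub>?L\<^esub> x = - x" for x
    by (rule L.minus_equality) (auto simp: ring_of_type_algebra_def)
  have inv: "inv\<^bsub>?L\<^esub> x = inverse x" if "x \<noteq> 0" for x
    by (rule L.inv_unique'[symmetric]) (use that in \<open>auto simp: ring_of_type_algebra_def\<close>)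
  show ?thesis
  proof (rule L.subfieldI'[OF L.subringI])
    show "\<one>\<^bsub>?L\<^esub> \<in> range to_ac"
      using to_ac_1 unfolding ring_of_type_algebra_def by (metis monoid.select_convs(2) rangeI)
    show "\<ominus>\<^bsub>?L\<^esub> h \<in> range to_ac" if "h \<in> range to_ac" for h
      using that unfolding neg by (auto simp flip: to_ac_minus)
    show "h1 \<otimes>\<^bsub>?L\<^esub> h2 \<in> range to_ac" if "h1 \<in> range to_ac" "h2 \<in> range to_ac" for h1 h2
      using that by (auto simp: ring_of_type_algebra_def simp flip: to_ac_mult)
    show "h1 \<oplus>\<^bsub>?L\<^esub> h2 \<in> range to_ac" if "h1 \<in> range to_ac" "h2 \<in> range to_ac" for h1 h2
      using that by (auto simp: ring_of_type_algebra_def simp flip: to_ac_add)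
    show "inv\<^bsub>?L\<^esub> k \<in> range to_ac" if "k \<in> range to_ac - {\<zero>\<^bsub>?L\<^esub>}" for k
    proof -
      have "k \<noteq> 0" using that by (auto simp: ring_of_type_algebra_def)
      thus ?thesis using that by (auto simp: inv simp flip: to_ac_inverse)
    qed
  qed (auto simp: ring_of_type_algebra_def)
qed

text \<open>
  The subfield generated by \<open>x\<close> is a finite extension, since \<open>x\<close> is a root of \<open>T\<^sup>n - a\<close>; that
  polynomial appears in the proof as the list of its coefficients, leading one first.
\<close>

lemma perfect_field_root_separable:
  fixes x :: "'k::field alg_closure"
  assumes "perfect_field TYPE('k)" and "n > 0" and "x ^ n = to_ac a"
  shows "separable_element x"
proof -
  let ?L = "ring_of_type_algebra :: 'k alg_closure ring"
  let ?k = "range (to_ac :: 'k \<Rightarrow> 'k alg_closure)"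
  interpret L: field ?L by (rule field_from_type_algebra)
  note k = subfield_range_to_ac[where ?'k = 'k]
  have carrier: "carrier ?L = UNIV" by (simp add: ring_of_type_algebra_def)
  have pow: "y [^]\<^bsub>?L\<^esub> m = y ^ m" for y :: "'k alg_closure" and m :: nat
    by (induction m) (auto simp: ring_of_type_algebra_def mult.commute nat_pow_def)
  let ?f = "1 # (replicate (n - 1) 0 @ [- to_ac a])"
  have zero: "0 = \<zero>\<^bsub>?L\<^esub>" by (simp add: ring_of_type_algebra_def)
  have "(L.algebraic over ?k) x"
  proof (rule L.algebraicI)
    have "0 \<in> ?k" "1 \<in> ?k" "- to_ac a \<in> ?k"
      by (rule range_eqI[of _ _ 0] range_eqI[of _ _ 1] range_eqI[of _ _ "- a"]; simp)+
    thus "?f \<in> carrier (?k[X]\<^bsub>?L\<^esub>)"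
      by (auto simp: univ_poly_carrier[symmetric] polynomial_def ring_of_type_algebra_def
          set_replicate_conv_if)
    have "L.eval (replicate (n - 1) 0 @ [- to_ac a]) x = L.eval [- to_ac a] x"
      unfolding zero by (rule L.eval_replicate) (auto simp: carrier)
    thus "L.eval ?f x = \<zero>\<^bsub>?L\<^esub>"
      using assms(2,3) by (simp add: pow) (simp add: ring_of_type_algebra_def)
  qed simp
  hence sub: "subfield (L.simple_extension ?k x) ?L"
    and fin: "L.finite_dimension ?k (L.simple_extension ?k x)"
    using L.simple_extension_is_subfield[OF k, of x]
      L.finite_dimensionI[OF L.dimension_simple_extension[OF k, of x]] by (auto simp: carrier)
  have "?k \<subseteq> L.simple_extension ?k x" "x \<in> L.simple_extension ?k x"
    using L.simple_extension_incl[of ?k x] L.simple_extension_mem[OF subfieldE(1)[OF k], of x]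
    by (auto simp: carrier)
  thus ?thesis
    using assms(1) sub fin unfolding perfect_field_def finite_extension_def by blast
qed

text \<open>
  Let \<open>x\<close> be the \<open>p\<close>-th root of \<open>a\<close> in the algebraic closure. Its minimal polynomial divides
  \<open>T\<^sup>p - a = (T - x)\<^sup>p\<close>, so \<open>x\<close> is its only root, and by separability a simple one. Hence the minimal
  polynomial is linear and \<open>x\<close> lies in the ground field.
\<close>

lemma perfect_field_pth_root:
  fixes a :: "'k::field"
  assumes "perfect_field TYPE('k)" and "CHAR('k) > 0"
  shows "\<exists>b. b ^ CHAR('k) = a"
proof -
  let ?p = "CHAR('k)"
  have prime: "prime ?p" using assms(2) by (rule prime_CHAR_semidom)
  obtain x :: "'k alg_closure" where x: "x ^ ?p = to_ac a"
    using nth_root_exists[OF assms(2)] by blast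
  obtain f :: "'k poly" where f: "poly (map_poly to_ac f) x = 0" "rsquarefree (map_poly to_ac f)"
    using perfect_field_root_separable[OF assms x] unfolding separable_element_def by blast
  obtain g :: "'k poly" where g: "g \<noteq> 0" "poly (map_poly to_ac g) x = 0"
    and min: "\<And>h. poly (map_poly to_ac h) x = 0 \<Longrightarrow> g dvd h"
    using exists_minimal_polynomial[of x] by blast
  let ?g = "map_poly to_ac g"
  have g0: "?g \<noteq> 0"
    using g(1) by (simp add: map_poly_eq_0_iff)
  obtain q where "f = g * q" using min[OF f(1)] by (elim dvdE)
  hence "map_poly to_ac f = ?g * map_poly to_ac q"
    by (simp add: map_poly_to_ac_mult)
  hence "order x ?g \<le> 1"
    using f(2) order_mult[of ?g "map_poly to_ac q" x] unfolding rsquarefree_def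
    by (metis add_leD1 le_numeral_extra(4) zero_le)
  moreover have "order x ?g \<noteq> 0"
    using g(2) g0 by (simp add: order_root)
  ultimately have "order x ?g = 1" by simp
  then obtain r where r: "?g = [:- x, 1:] * r" "\<not> [:- x, 1:] dvd r"
    using order_decomp[OF g0, of x] by (metis power_one_right)
  have rx: "poly r x \<noteq> 0" using r(2) by (simp add: poly_eq_0_iff_dvd)
  have root: "y = x" if y: "poly ?g y = 0" for y
  proof -
    define h where "h = monom 1 ?p - [:a:]"
    have h: "map_poly to_ac h = monom 1 ?p - [:to_ac a:]"
      unfolding h_def by (rule poly_eqI) (auto simp: coeff_map_poly coeff_pCons split: nat.splits)
    have "g dvd h"
      by (rule min) (simp add: h poly_monom x)
    then obtain s where "h = g * s" by (elim dvdE)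
    hence "poly (map_poly to_ac h) y = 0"
      using y by (simp add: map_poly_to_ac_mult)
    hence "y ^ ?p = x ^ ?p"
      by (simp add: h poly_monom x)
    moreover have "y ^ ?p = (y - x) ^ ?p + x ^ ?p"
    proof -
      have "(y - x + x) ^ ?p = (y - x) ^ ?p + x ^ ?p"
        by (rule freshmans_dream) (use prime in simp_all)
      thus ?thesis by simp
    qed
    ultimately have "(y - x) ^ ?p = 0"
      by (metis add_cancel_left_left)
    thus ?thesis by simp
  qed
  have "degree r = 0"
  proof (rule ccontr)
    assume "degree r \<noteq> 0"
    then obtain y where "poly r y = 0"
      using alg_closed_imp_poly_has_root[of r] by auto
    thus False using root[of y] r(1) rx by auto
  qed
  moreover have "r \<noteq> 0" using rx by auto
  ultimately have "degree ?g = 1"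
    unfolding r(1) by (subst degree_mult_eq) auto
  hence deg: "degree g = 1"
    by (simp add: degree_map_poly)
  then obtain c d where cd: "g = [:c, d:]" "d \<noteq> 0"
    by (rule degree1_coeffs)
  have "to_ac c + x * to_ac d = 0"
    using g(2) unfolding cd(1) by (simp add: map_poly_pCons)
  hence "x = to_ac (- c / d)"
    using cd(2) by (simp add: field_simps eq_neg_iff_add_eq_0)
  hence "to_ac ((- c / d) ^ ?p) = to_ac a"
    using x by simp
  thus ?thesis by (intro exI[of _ "- c / d"]) (simp only: to_ac_eq_iff)
qed

lemma coeff_additive_poly:
  fixes c :: "nat \<Rightarrow> 'a::comm_ring_1"
  assumes "p > 1" "j \<le> n"
  shows "coeff (monom 1 (p ^ n) - [:b:] - (\<Sum>i<n. monom (c i) (p ^ i))) (p ^ j) =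
    (if j = n then 1 else - c j)"
proof -
  have "p ^ i = p ^ j \<longleftrightarrow> i = j" for i
    using assms(1) by simp
  moreover have "coeff [:b:] (p ^ j) = 0"
    using assms(1) by (auto simp: coeff_pCons split: nat.splits)
  ultimately show ?thesis
    using assms(2) by (auto simp: coeff_sum sum.delta)
qed

lemma additive_equation_root:
  fixes c :: "nat \<Rightarrow> 'a::alg_closed_field"
  assumes "p > 1"
  shows "\<exists>z. z ^ (p ^ n) = b + (\<Sum>i<n. c i * z ^ (p ^ i))"
proof -
  let ?q = "monom 1 (p ^ n) - [:b:] - (\<Sum>i<n. monom (c i) (p ^ i))"
  have "coeff ?q (p ^ n) = 1"
    using coeff_additive_poly[OF assms order.refl, of n b c] by (simp only: if_True refl)
  hence "degree ?q \<ge> p ^ n"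
    by (intro le_degree) (simp only: one_neq_zero not_False_eq_True)
  hence "degree ?q > 0"
    using assms by (metis gr_zeroI le_zero_eq power_eq_0_iff less_zeroE)
  then obtain z where "poly ?q z = 0"
    using alg_closed_imp_poly_has_root by blast
  thus ?thesis
    by (intro exI[of _ z]) (simp add: poly_monom poly_sum algebra_simps)
qed

text \<open>
  If \<open>0\<close> were the only root, the polynomial would be a monomial over an algebraically closed field;
  but it has the two nonzero coefficients at \<open>p\<^sup>n\<close> and \<open>p\<^sup>j\<close>.
\<close>

lemma additive_equation_nonzero_root:
  fixes c :: "nat \<Rightarrow> 'a::alg_closed_field"
  assumes "p > 1" and j: "j < n" "c j \<noteq> 0"
  shows "\<exists>z. z \<noteq> 0 \<and> z ^ (p ^ n) = (\<Sum>i<n. c i * z ^ (p ^ i))"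
proof (rule ccontr)
  assume *: "\<not> ?thesis"
  let ?q = "monom 1 (p ^ n) - [:0:] - (\<Sum>i<n. monom (c i) (p ^ i))"
  have root: "z = 0" if "poly ?q z = 0" for z
    using * that by (auto simp: poly_monom poly_sum)
  have cn: "coeff ?q (p ^ n) \<noteq> 0" and cj: "coeff ?q (p ^ j) \<noteq> 0"
    using coeff_additive_poly[OF assms(1), of n n 0 c] coeff_additive_poly[OF assms(1), of j n 0 c] j
    by auto
  hence "?q \<noteq> 0" by (metis coeff_0)
  then obtain r where r: "?q = [:- 0, 1:] ^ order 0 ?q * r" "\<not> [:- 0, 1:] dvd r"
    using order_decomp by blast
  have r0: "poly r 0 \<noteq> 0" using r(2) by (simp add: poly_eq_0_iff_dvd)
  have "degree r = 0"
  proof (rule ccontr)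
    assume "degree r \<noteq> 0"
    then obtain z where z: "poly r z = 0"
      using alg_closed_imp_poly_has_root[of r] by auto
    hence "poly ?q z = 0" by (subst r(1)) simp
    thus False using root z r0 by blast
  qed
  then obtain a where a: "r = [:a:]" by (rule degree_eq_zeroE)
  define m where "m = order 0 ?q"
  have "?q = monom a m"
    unfolding m_def by (subst r(1)) (simp add: a monom_altdef)
  hence "p ^ n = m" "p ^ j = m"
    using cn cj by (auto simp: coeff_monom split: if_splits)
  thus False using assms(1) j(1) by (metis nat_neq_iff power_inject_exp)
qed

section \<open>Maximal left ideals and the Jacobson radical\<close>

context ring
begin

lemma left_idealI:
  assumes "I \<subseteq> carrier R" "\<zero> \<in> I" "\<And>x y. x \<in> I \<Longrightarrow> y \<in> I \<Longrightarrow> x \<oplus> y \<in> I"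
    and mult: "\<And>r x. r \<in> carrier R \<Longrightarrow> x \<in> I \<Longrightarrow> r \<otimes> x \<in> I"
  shows "left_ideal I R"
proof -
  have neg: "\<ominus> x \<in> I" if "x \<in> I" for x
    using mult[of "\<ominus> \<one>" x] that assms(1) by (auto simp: l_minus)
  have "subgroup I (add_monoid R)"
    by (rule add.subgroupI) (use assms neg in \<open>auto simp: a_inv_def[symmetric]\<close>)
  thus ?thesis
    unfolding left_ideal_def using mult by (auto intro: additive_subgroup.intro)
qed

lemma left_idealD:
  assumes "left_ideal I R"
  shows "I \<subseteq> carrier R" "\<zero> \<in> I" "\<And>x y. x \<in> I \<Longrightarrow> y \<in> I \<Longrightarrow> x \<oplus> y \<in> I"
    "\<And>r x. r \<in> carrier R \<Longrightarrow> x \<in> I \<Longrightarrow> r \<otimes> x \<in> I"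
proof -
  interpret additive_subgroup I R
    using assms unfolding left_ideal_def by blast
  show "I \<subseteq> carrier R" "\<zero> \<in> I" "\<And>x y. x \<in> I \<Longrightarrow> y \<in> I \<Longrightarrow> x \<oplus> y \<in> I"
    using a_subset zero_closed a_closed by auto
  show "r \<otimes> x \<in> I" if "r \<in> carrier R" "x \<in> I" for r x
    using assms that unfolding left_ideal_def by blast
qed

lemma left_ideal_Inter:
  assumes "\<And>M. M \<in> \<M> \<Longrightarrow> left_ideal M R"
  shows "left_ideal (carrier R \<inter> \<Inter>\<M>) R"
  using left_idealD[OF assms] by (intro left_idealI) auto

lemma left_ideal_one_imp_carrier:
  assumes "left_ideal I R" "\<one> \<in> I"
  shows "I = carrier R"
proof
  show "carrier R \<subseteq> I"
    using left_idealD(4)[OF assms(1) _ assms(2)] by auto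
qed (use left_idealD[OF assms(1)] in auto)

text \<open>
  Right multiplication by \<open>r\<close> embeds the quotient of \<open>R\<close> by the left ideal \<open>(M : r)\<close> into the simple module
  \<open>R / M\<close>, so \<open>(M : r)\<close> is again maximal. Consequently the intersection of all maximal left ideals
  is closed under right multiplication.
\<close>

lemma maximal_left_ideal_colon:
  assumes M: "maximal_left_ideal M R" and r: "r \<in> carrier R" "r \<notin> M"
  shows "maximal_left_ideal {s \<in> carrier R. s \<otimes> r \<in> M} R" (is "maximal_left_ideal ?C R")
  unfolding maximal_left_ideal_def
proof (intro conjI allI impI; (elim conjE)?)
  have M': "left_ideal M R"
    using M unfolding maximal_left_ideal_def by blast
  note Md = left_idealD[OF M']
  show "left_ideal ?C R"
    by (rule left_idealI) (use r Md in \<open>auto simp: l_distr m_assoc\<close>)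
  show "?C \<noteq> carrier R"
    using r by (metis (mono_tags, lifting) l_one mem_Collect_eq one_closed)
  fix I assume I: "left_ideal I R" and CI: "?C \<subseteq> I"
  note Id = left_idealD[OF I]
  show "I = ?C \<or> I = carrier R"
  proof (rule ccontr)
    assume "\<not> (I = ?C \<or> I = carrier R)"
    then obtain s where s: "s \<in> I" "s \<otimes> r \<notin> M" and nI: "I \<noteq> carrier R"
      using CI Id(1) by blast
    have sc: "s \<in> carrier R" using s Id by auto
    let ?N = "{m \<oplus> t \<otimes> (s \<otimes> r) | m t. m \<in> M \<and> t \<in> carrier R}"
    have "left_ideal ?N R"
    proof (rule left_idealI)
      show "?N \<subseteq> carrier R" using Md sc r by auto
      show "\<zero> \<in> ?N"
        using Md sc r by (intro CollectI exI[of _ \<zero>] exI[of _ \<zero>]) auto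
    next
      fix x y assume "x \<in> ?N" "y \<in> ?N"
      then obtain m t m' t' where "x = m \<oplus> t \<otimes> (s \<otimes> r)" "y = m' \<oplus> t' \<otimes> (s \<otimes> r)"
        "m \<in> M" "t \<in> carrier R" "m' \<in> M" "t' \<in> carrier R"
        by auto
      thus "x \<oplus> y \<in> ?N"
        using Md(1,3) sc r
        by (intro CollectI exI[of _ "m \<oplus> m'"] exI[of _ "t \<oplus> t'"])
          (auto simp: l_distr a_ac subset_iff)
    next
      fix a x assume "a \<in> carrier R" "x \<in> ?N"
      then obtain m t where "x = m \<oplus> t \<otimes> (s \<otimes> r)" "m \<in> M" "t \<in> carrier R"
        by auto
      thus "a \<otimes> x \<in> ?N"
        using Md(1,4) sc r \<open>a \<in> carrier R\<close>
        by (intro CollectI exI[of _ "a \<otimes> m"] exI[of _ "a \<otimes> t"])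
          (auto simp: r_distr m_assoc subset_iff)
    qed
    moreover have "M \<subseteq> ?N"
    proof
      fix m assume "m \<in> M"
      thus "m \<in> ?N"
        using Md(1) sc r by (intro CollectI exI[of _ m] exI[of _ \<zero>]) auto
    qed
    moreover have "s \<otimes> r \<in> ?N"
      using Md sc r by (intro CollectI exI[of _ \<zero>] exI[of _ \<one>]) auto
    ultimately have "?N = carrier R"
      using M s(2) unfolding maximal_left_ideal_def by blast
    with r(1) obtain m t where m: "r = m \<oplus> t \<otimes> (s \<otimes> r)" "m \<in> M" "t \<in> carrier R"
      by blast
    have mc: "m \<in> carrier R" using m Md by auto
    have "(\<one> \<ominus> t \<otimes> s) \<otimes> r = r \<ominus> t \<otimes> (s \<otimes> r)"
      using sc r m(3) by (simp add: a_minus_def l_distr l_minus m_assoc)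
    also have "\<dots> = (m \<oplus> t \<otimes> (s \<otimes> r)) \<ominus> t \<otimes> (s \<otimes> r)"
      using m(1) by simp
    also have "\<dots> = m"
      using mc m(3) sc r by (simp add: a_minus_def a_assoc r_neg)
    finally have "\<one> \<ominus> t \<otimes> s \<in> I"
      using CI m(2,3) sc by auto
    hence "(\<one> \<ominus> t \<otimes> s) \<oplus> t \<otimes> s \<in> I"
      using Id(3,4) s(1) m(3) by blast
    moreover have "(\<one> \<ominus> t \<otimes> s) \<oplus> t \<otimes> s = \<one>"
      using sc m(3) by (simp add: a_minus_def a_assoc l_neg)
    ultimately show False
      using left_ideal_one_imp_carrier[OF I] nI by simp
  qed
qed

lemma ideal_jacobson_radical: "ideal (jacobson_radical R) R"
proof -
  let ?J = "jacobson_radical R"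
  have "?J = carrier R \<inter> \<Inter>{M. maximal_left_ideal M R}"
    unfolding jacobson_radical_def by auto
  hence J: "left_ideal ?J R"
    using left_ideal_Inter[of "{M. maximal_left_ideal M R}"]
    unfolding maximal_left_ideal_def by auto
  have "x \<otimes> r \<in> ?J" if x: "x \<in> ?J" and r: "r \<in> carrier R" for x r
  proof -
    have xc: "x \<in> carrier R"
      using x unfolding jacobson_radical_def by auto
    have "x \<otimes> r \<in> M" if M: "maximal_left_ideal M R" for M
    proof (cases "r \<in> M")
      case True
      thus ?thesis
        using M xc left_idealD(4) unfolding maximal_left_ideal_def by blast
    next
      case False
      thus ?thesis
        using maximal_left_ideal_colon[OF M r False] x unfolding jacobson_radical_def by blast
    qed
    thus ?thesis
      using xc r unfolding jacobson_radical_def by auto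
  qed
  thus ?thesis
    using J unfolding left_ideal_def
    by (intro idealI ring_axioms) (auto simp: additive_subgroup_def)
qed

end

context ideal
begin

lemma carrier_quotient: "carrier (R Quot I) = (+>) I ` carrier R"
  by (auto simp: FactRing_simps)

lemma coset_in_image_iff:
  assumes "left_ideal A R" "I \<subseteq> A" "x \<in> carrier R"
  shows "I +> x \<in> (+>) I ` A \<longleftrightarrow> x \<in> A"
proof
  assume "I +> x \<in> (+>) I ` A"
  then obtain a where a: "a \<in> A" "I +> x = I +> a" by auto
  note Ad = left_idealD[OF assms(1)]
  have ac: "a \<in> carrier R" using a Ad by auto
  have "x \<ominus> a \<in> I"
    using a ac assms(3) quotient_eq_iff_same_a_r_cos[OF ideal_axioms] by simp
  hence "(x \<ominus> a) \<oplus> a \<in> A"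
    using assms(2) a(1) Ad(3) by blast
  thus "x \<in> A"
    using ac assms(3) by (simp add: a_minus_def a_assoc l_neg)
qed auto

lemma left_ideal_image:
  assumes "left_ideal A R"
  shows "left_ideal ((+>) I ` A) (R Quot I)"
proof -
  note Ad = left_idealD[OF assms]
  interpret h: ring_hom_ring R "R Quot I" "(+>) I"
    by (rule rcos_ring_hom_ring)
  show ?thesis
  proof (rule ring.left_idealI[OF quotient_is_ring])
    show "(+>) I ` A \<subseteq> carrier (R Quot I)"
      using Ad(1) carrier_quotient by auto
    show "\<zero>\<^bsub>R Quot I\<^esub> \<in> (+>) I ` A"
      using Ad(2) h.hom_zero by (metis imageI)
  next
    fix x y assume "x \<in> (+>) I ` A" "y \<in> (+>) I ` A"
    then obtain a b where "x = I +> a" "y = I +> b" "a \<in> A" "b \<in> A" by auto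
    moreover have "I +> (a \<oplus> b) \<in> (+>) I ` A"
      using calculation Ad(3) by blast
    ultimately show "x \<oplus>\<^bsub>R Quot I\<^esub> y \<in> (+>) I ` A"
      using Ad(1) by (auto simp: subset_iff)
  next
    fix r x assume "r \<in> carrier (R Quot I)" "x \<in> (+>) I ` A"
    then obtain a b where "r = I +> a" "x = I +> b" "a \<in> carrier R" "b \<in> A"
      using carrier_quotient by auto
    moreover have "I +> (a \<otimes> b) \<in> (+>) I ` A"
      using calculation Ad(4) by blast
    ultimately show "r \<otimes>\<^bsub>R Quot I\<^esub> x \<in> (+>) I ` A"
      using Ad(1) by (auto simp: subset_iff)
  qed
qed

lemma left_ideal_preimage:
  assumes "left_ideal B (R Quot I)"
  shows "left_ideal {x \<in> carrier R. I +> x \<in> B} R"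
proof -
  interpret h: ring_hom_ring R "R Quot I" "(+>) I"
    by (rule rcos_ring_hom_ring)
  note Bd = ring.left_idealD[OF quotient_is_ring assms]
  show ?thesis
  proof (rule left_idealI)
    show "\<zero> \<in> {x \<in> carrier R. I +> x \<in> B}"
      using Bd(2) h.hom_zero by simp
  qed (use Bd in auto)
qed

lemma maximal_left_ideal_image:
  assumes M: "maximal_left_ideal M R" and "I \<subseteq> M"
  shows "maximal_left_ideal ((+>) I ` M) (R Quot I)"
  unfolding maximal_left_ideal_def
proof (intro conjI allI impI; (elim conjE)?)
  have M': "left_ideal M R" "M \<noteq> carrier R"
    using M unfolding maximal_left_ideal_def by auto
  show "left_ideal ((+>) I ` M) (R Quot I)"
    by (rule left_ideal_image[OF M'(1)])
  show "(+>) I ` M \<noteq> carrier (R Quot I)"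
  proof
    assume "(+>) I ` M = carrier (R Quot I)"
    hence "I +> x \<in> (+>) I ` M" if "x \<in> carrier R" for x
      using that carrier_quotient by simp
    hence "carrier R \<subseteq> M"
      using coset_in_image_iff[OF M'(1) assms(2)] by (intro subsetI) simp
    thus False using M'(2) left_idealD(1)[OF M'(1)] by blast
  qed
  fix B assume B: "left_ideal B (R Quot I)" and MB: "(+>) I ` M \<subseteq> B"
  let ?A = "{x \<in> carrier R. I +> x \<in> B}"
  have "M \<subseteq> ?A"
    using MB left_idealD(1)[OF M'(1)] by auto
  with left_ideal_preimage[OF B] have "?A = M \<or> ?A = carrier R"
    using M unfolding maximal_left_ideal_def by simp
  moreover have B_eq: "(+>) I ` ?A = B"
    using ring.left_idealD(1)[OF quotient_is_ring B] carrier_quotient by auto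
  have "(+>) I ` M = B" if "?A = M"
    using B_eq unfolding that .
  moreover have "carrier (R Quot I) = B" if "?A = carrier R"
    using B_eq unfolding that carrier_quotient .
  ultimately show "B = (+>) I ` M \<or> B = carrier (R Quot I)"
    by blast
qed

lemma left_artinian_quotient_chain:
  assumes "left_artinian (R Quot I)"
    and A: "\<And>n. left_ideal (A n) R" "\<And>n. I \<subseteq> A n" "\<And>n. A (Suc n) \<subseteq> A n"
  shows "\<exists>N. \<forall>n\<ge>N. A n = A N"
proof -
  have "left_ideal ((+>) I ` A n) (R Quot I)" "(+>) I ` A (Suc n) \<subseteq> (+>) I ` A n" for n
    by (rule left_ideal_image[OF A(1)], rule image_mono[OF A(3)])
  then obtain N where N: "\<forall>n\<ge>N. (+>) I ` A n = (+>) I ` A N"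
    using assms(1)[unfolded left_artinian_def, rule_format, of "\<lambda>n. (+>) I ` A n"] by auto
  have "A n = A N" if "n \<ge> N" for n
  proof (rule Set.set_eqI)
    fix x
    show "x \<in> A n \<longleftrightarrow> x \<in> A N"
    proof (cases "x \<in> carrier R")
      case True
      have "I +> x \<in> (+>) I ` A n \<longleftrightarrow> I +> x \<in> (+>) I ` A N"
        using N[rule_format, OF that] by simp
      thus ?thesis
        unfolding coset_in_image_iff[OF A(1,2) True] .
    next
      case False
      thus ?thesis using left_idealD(1)[OF A(1)] by blast
    qed
  qed
  thus ?thesis by blast
qed

text \<open>
  The form in which semiperfectness enters. A decreasing chain of intersections of maximal left ideals
  survives in the quotient by the Jacobson radical, because each member contains the radical. Stating
  it for ideals of \<open>R\<close> that contain \<open>I\<close> avoids computing with cosets of cosets.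
\<close>

theorem left_artinian_radical_quotient_chain:
  assumes art: "left_artinian ((R Quot I) Quot jacobson_radical (R Quot I))"
    and max: "\<And>n M. M \<in> \<M> n \<Longrightarrow> maximal_left_ideal M R \<and> I \<subseteq> M"
    and dec: "\<And>n. \<M> n \<subseteq> \<M> (Suc n)"
  shows "\<exists>N. \<forall>n\<ge>N. carrier R \<inter> \<Inter>(\<M> n) = carrier R \<inter> \<Inter>(\<M> N)"
proof -
  let ?A = "\<lambda>n. carrier R \<inter> \<Inter>(\<M> n)"
  interpret S: ring "R Quot I" by (rule quotient_is_ring)
  interpret J: ideal "jacobson_radical (R Quot I)" "R Quot I"
    by (rule S.ideal_jacobson_radical)
  have A: "left_ideal (?A n) R" for n
    using max unfolding maximal_left_ideal_def by (intro left_ideal_Inter) blast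
  have IA: "I \<subseteq> ?A n" for n
    using max a_subset by blast
  have "\<exists>N. \<forall>n\<ge>N. (+>) I ` ?A n = (+>) I ` ?A N"
  proof (rule J.left_artinian_quotient_chain[OF art])
    show "left_ideal ((+>) I ` ?A n) (R Quot I)" for n
      by (rule left_ideal_image[OF A])
    show "(+>) I ` ?A (Suc n) \<subseteq> (+>) I ` ?A n" for n
      using dec[of n] by (intro image_mono) blast
    show "jacobson_radical (R Quot I) \<subseteq> (+>) I ` ?A n" for n
    proof
      fix c assume c: "c \<in> jacobson_radical (R Quot I)"
      then obtain x where x: "c = I +> x" "x \<in> carrier R"
        using carrier_quotient unfolding jacobson_radical_def by auto
      have "x \<in> M" if M: "M \<in> \<M> n" for M
      proof -
        have M': "maximal_left_ideal M R" "I \<subseteq> M" using max[OF M] by auto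
        have "c \<in> (+>) I ` M"
          using c maximal_left_ideal_image[OF M'] unfolding jacobson_radical_def by blast
        thus ?thesis
          using coset_in_image_iff[OF _ M'(2) x(2)] M'(1) x(1)
          unfolding maximal_left_ideal_def by blast
      qed
      thus "c \<in> (+>) I ` ?A n" using x by blast
    qed
  qed
  then obtain N where N: "\<And>n. n \<ge> N \<Longrightarrow> (+>) I ` ?A n = (+>) I ` ?A N" by blast
  have "?A n = ?A N" if "n \<ge> N" for n
  proof (rule Set.set_eqI)
    fix x
    show "x \<in> ?A n \<longleftrightarrow> x \<in> ?A N"
    proof (cases "x \<in> carrier R")
      case True
      have "I +> x \<in> (+>) I ` ?A n \<longleftrightarrow> I +> x \<in> (+>) I ` ?A N"
        using N[OF that] by simp
      thus ?thesis
        unfolding coset_in_image_iff[OF A IA True] .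
    qed simp
  qed
  thus ?thesis by blast
qed

end

section \<open>The ideal of p-nilpotent elements\<close>

context restricted_lie_algebra
begin

lemma prime_char: "prime CHAR('k)"
  using char_pos by (rule prime_CHAR_semidom)

lemma bracket_zero_left [simp]: "bracket 0 x = 0"
  using bracket_add_left[of 0 0 x] by simp

lemma bracket_zero_right [simp]: "bracket x 0 = 0"
  using bracket_add_right[of x 0 0] by simp

lemma bracket_flip: "bracket y x = - bracket x y"
proof -
  have "bracket (x + y) (x + y) = bracket x y + bracket y x"
    by (subst bracket_add_left) (simp add: bracket_add_right bracket_self)
  thus ?thesis
    unfolding bracket_self[of "x + y"] by (simp add: eq_neg_iff_add_eq_0 add.commute)
qed

lemma bracket_minus_right: "bracket x (- y) = - bracket x y"
  using bracket_add_right[of x y "- y"] by (simp add: eq_neg_iff_add_eq_0 add.commute)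

lemma bracket_leibniz: "bracket x (bracket y z) = bracket (bracket x y) z + bracket y (bracket x z)"
proof -
  have "bracket (bracket x y) z = - bracket z (bracket x y)"
    by (rule bracket_flip)
  moreover have "bracket y (bracket z x) = - bracket y (bracket x z)"
    by (simp add: bracket_flip[of z x] bracket_minus_right)
  ultimately show ?thesis
    using jacobi[of x y z] by (simp add: algebra_simps)
qed

lemma pmap_zero [simp]: "pmap 0 = 0"
  using pmap_scale[of 0 0] char_pos by (simp add: power_0_left)

lemma funpow_pmap_zero [simp]: "(pmap ^^ n) 0 = 0"
  by (induction n) auto

lemma bracket_pmap_fun: "bracket (pmap x) = bracket x ^^ CHAR('k)"
  by (rule ext) (rule bracket_pmap)

lemma bracket_funpow_pmap: "bracket ((pmap ^^ n) x) = bracket x ^^ (CHAR('k) ^ n)"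
  by (induction n) (simp_all add: bracket_pmap_fun funpow_mult mult.commute)

text \<open>
  Every Jacobson term is an iterated bracket that starts from \<open>x\<close> and has at least one further
  factor, since \<open>p \<ge> 2\<close>. The two sets allow for three uses: \<open>S = S'\<close> a subalgebra normalized by \<open>y\<close>;
  \<open>S\<close> a subalgebra and \<open>S'\<close> containing its brackets; \<open>S\<close> everything and \<open>S'\<close> containing
  all brackets. Each gives additivity of the \<open>p\<close>-map modulo \<open>S'\<close>.
\<close>

lemma jacobson_term_mem:
  assumes "subspace S'" "S' \<subseteq> S" "x \<in> S"
    and "\<And>a. a \<in> S \<Longrightarrow> bracket x a \<in> S'" "\<And>a. a \<in> S \<Longrightarrow> bracket y a \<in> S'"
  shows "jacobson_term i x y \<in> S'"
proof -
  have step: "coeff (ad_poly x y f) j \<in> S'" if "\<And>j. coeff f j \<in> S" for f j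
    unfolding ad_poly_def coeff_add coeff_pCons using that assms
    by (auto simp: coeff_map_poly subspace_0 intro!: subspace_add split: nat.splits)
  have all: "coeff ((ad_poly x y ^^ m) [:x:]) j \<in> S" for m j
  proof (induction m arbitrary: j)
    case 0
    thus ?case
      using assms subspace_0 by (auto simp: coeff_pCons split: nat.splits)
  next
    case (Suc m)
    show ?case using step[OF Suc.IH] assms(2) by auto
  qed
  obtain m where m: "CHAR('k) - 1 = Suc m"
    using prime_gt_1_nat[OF prime_char] by (metis Suc_diff_Suc One_nat_def)
  show ?thesis
    unfolding jacobson_term_def m using step[OF all] assms(1)
    by (auto intro: subspace_scale)
qed

lemma pmap_add_mod:
  assumes "subspace S'" "S' \<subseteq> S" "x \<in> S"
    and "\<And>a. a \<in> S \<Longrightarrow> bracket x a \<in> S'" "\<And>a. a \<in> S \<Longrightarrow> bracket y a \<in> S'"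
  shows "pmap (x + y) - (pmap x + pmap y) \<in> S'"
  unfolding pmap_add using jacobson_term_mem[OF assms] assms(1)
  by (auto intro: subspace_sum)

text \<open>
  The conclusion of Engel's theorem, for \<open>Q\<close> acting on a subquotient \<open>V / (V \<inter> W)\<close> of the adjoint
  representation: a nonzero subquotient contains a nonzero vector killed by \<open>Q\<close>. Allowing all
  subquotients makes the property pass to one-dimensional extensions of \<open>Q\<close>.
\<close>

definition engel :: "'l set \<Rightarrow> bool" where
  "engel Q \<longleftrightarrow> (\<forall>V W. subspace V \<and> subspace W \<and>
     (\<forall>q\<in>Q. \<forall>v\<in>V. bracket q v \<in> V) \<and> (\<forall>q\<in>Q. \<forall>w\<in>W. bracket q w \<in> W) \<and> \<not> V \<subseteq> W \<longrightarrow>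
     (\<exists>v\<in>V - W. \<forall>q\<in>Q. bracket q v \<in> W))"

lemma engelD:
  assumes "engel Q" "subspace V" "subspace W"
    "\<And>q v. q \<in> Q \<Longrightarrow> v \<in> V \<Longrightarrow> bracket q v \<in> V" "\<And>q w. q \<in> Q \<Longrightarrow> w \<in> W \<Longrightarrow> bracket q w \<in> W"
    "\<not> V \<subseteq> W"
  obtains v where "v \<in> V" "v \<notin> W" "\<And>q. q \<in> Q \<Longrightarrow> bracket q v \<in> W"
  using assms unfolding engel_def by (metis DiffE)

text \<open>
  The vectors of \<open>V\<close> that \<open>Q\<close> moves into \<open>W\<close> form a space that \<open>y\<close> preserves, because \<open>y\<close>
  normalizes \<open>Q\<close>. As \<open>y\<close> acts nilpotently, the last of the iterates of such a vector under \<open>y\<close> to lie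
  outside \<open>W\<close> is killed modulo \<open>W\<close> by \<open>y\<close> as well.
\<close>

lemma engel_add_line:
  assumes Q: "engel Q" and norm: "\<And>q. q \<in> Q \<Longrightarrow> bracket y q \<in> Q"
    and "0 \<in> Q" and nil: "\<And>v. (bracket y ^^ m) v = 0"
  shows "engel {q + scale c y | q c. q \<in> Q}" (is "engel ?Q'")
  unfolding engel_def
proof (intro allI impI, elim conjE)
  fix V W
  assume V: "subspace V" and W: "subspace W" and nVW: "\<not> V \<subseteq> W"
    and VV: "\<forall>q\<in>?Q'. \<forall>v\<in>V. bracket q v \<in> V" and WW: "\<forall>q\<in>?Q'. \<forall>v\<in>W. bracket q v \<in> W"
  have Q_sub: "q \<in> ?Q'" if "q \<in> Q" for q
    using that by (intro CollectI exI[of _ q] exI[of _ 0]) simp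
  have y_in: "y \<in> ?Q'"
    using \<open>0 \<in> Q\<close> by (intro CollectI exI[of _ 0] exI[of _ 1]) simp
  obtain v0 where v0: "v0 \<in> V" "v0 \<notin> W" "\<And>q. q \<in> Q \<Longrightarrow> bracket q v0 \<in> W"
  proof (rule engelD[OF Q V W])
    show "bracket q v \<in> V" if "q \<in> Q" "v \<in> V" for q v
      using VV Q_sub[OF that(1)] that(2) by blast
    show "bracket q w \<in> W" if "q \<in> Q" "w \<in> W" for q w
      using WW Q_sub[OF that(1)] that(2) by blast
  qed (use nVW in auto)
  have inv: "(bracket y ^^ i) v0 \<in> V \<and> (\<forall>q\<in>Q. bracket q ((bracket y ^^ i) v0) \<in> W)" for i
  proof (induction i)
    case (Suc i)
    let ?v = "(bracket y ^^ i) v0"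
    have "bracket q (bracket y ?v) \<in> W" if q: "q \<in> Q" for q
    proof -
      have "bracket q (bracket y ?v) = bracket y (bracket q ?v) - bracket (bracket y q) ?v"
        by (simp add: bracket_leibniz[of y q])
      thus ?thesis
        using Suc.IH q norm[OF q] WW y_in W by (auto intro: subspace_diff)
    qed
    thus ?case using Suc.IH VV y_in by auto
  qed (use v0 in auto)
  define i where "i = (LEAST i. (bracket y ^^ i) v0 \<in> W)"
  have "(bracket y ^^ m) v0 \<in> W"
    using nil subspace_0[OF W] by simp
  hence i: "(bracket y ^^ i) v0 \<in> W"
    unfolding i_def by (rule LeastI)
  with v0 obtain j where j: "i = Suc j"
    by (cases i) auto
  have nj: "(bracket y ^^ j) v0 \<notin> W"
    using not_less_Least[of j "\<lambda>i. (bracket y ^^ i) v0 \<in> W"] j unfolding i_def by simp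
  let ?v = "(bracket y ^^ j) v0"
  have "bracket (q + scale c y) ?v \<in> W" if "q \<in> Q" for q c
    using that inv[of j] i j W
    by (auto simp: bracket_add_left bracket_scale_left intro!: subspace_add subspace_scale)
  thus "\<exists>v\<in>V - W. \<forall>q\<in>?Q'. bracket q v \<in> W"
    using inv[of j] nj by auto
qed

definition p_nil_engel :: "'l set \<Rightarrow> bool" where
  "p_nil_engel Q \<longleftrightarrow> restricted_subalgebra Q \<and> p_nil Q \<and> engel Q"

lemma p_nilpotent_iff_pmap: "p_nilpotent (pmap x) \<longleftrightarrow> p_nilpotent x"
proof
  assume "p_nilpotent (pmap x)"
  then obtain n where "(pmap ^^ n) (pmap x) = 0"
    unfolding p_nilpotent_def by auto
  hence "(pmap ^^ Suc n) x = 0"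
    by (simp add: funpow_swap1)
  thus "p_nilpotent x"
    unfolding p_nilpotent_def by (intro exI[of _ "Suc n"]) auto
next
  assume "p_nilpotent x"
  then obtain n where "n \<ge> 1" "(pmap ^^ n) x = 0"
    unfolding p_nilpotent_def by auto
  thus "p_nilpotent (pmap x)"
    unfolding p_nilpotent_def
    by (intro exI[of _ n]) (simp flip: funpow_swap1)
qed

lemma p_nilpotent_iff_funpow_pmap: "p_nilpotent ((pmap ^^ n) x) \<longleftrightarrow> p_nilpotent x"
  by (induction n) (auto simp: p_nilpotent_iff_pmap)

text \<open>
  If \<open>y\<close> normalizes \<open>Q\<close> and its \<open>p\<close>-th power lies in \<open>Q\<close>, then the \<open>p\<close>-map sends all of
  \<open>Q + k y\<close> into \<open>Q\<close>; this is why enlarging by a single line suffices for a restricted subalgebra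
  and keeps it \<open>p\<close>-nil.
\<close>

lemma p_nil_engel_add_line:
  assumes Q: "p_nil_engel Q" and norm: "\<And>q. q \<in> Q \<Longrightarrow> bracket y q \<in> Q"
    and Fy: "pmap y \<in> Q"
  shows "p_nil_engel {q + scale c y | q c. q \<in> Q}" (is "p_nil_engel ?Q'")
proof -
  have sub: "subspace Q" and br: "\<And>a b. a \<in> Q \<Longrightarrow> b \<in> Q \<Longrightarrow> bracket a b \<in> Q"
    and FQ: "\<And>a. a \<in> Q \<Longrightarrow> pmap a \<in> Q" and nilQ: "\<And>a. a \<in> Q \<Longrightarrow> p_nilpotent a" and "engel Q"
    using Q unfolding p_nil_engel_def restricted_subalgebra_def p_nil_def by auto
  have Q_sub: "q \<in> ?Q'" if "q \<in> Q" for q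
    using that by (intro CollectI exI[of _ q] exI[of _ 0]) simp
  have norm': "bracket q y \<in> Q" if "q \<in> Q" for q
    using norm[OF that] subspace_neg[OF sub] by (subst bracket_flip) auto
  have sub': "subspace ?Q'"
  proof (rule subspaceI)
    show "0 \<in> ?Q'" using subspace_0[OF sub] Q_sub by blast
  next
    fix a b assume "a \<in> ?Q'" "b \<in> ?Q'"
    then obtain q c r d where "a = q + scale c y" "b = r + scale d y" "q \<in> Q" "r \<in> Q"
      by auto
    thus "a + b \<in> ?Q'"
      using subspace_add[OF sub]
      by (intro CollectI exI[of _ "q + r"] exI[of _ "c + d"]) (auto simp: scale_left_distrib)
  next
    fix e a assume "a \<in> ?Q'"
    then obtain q c where "a = q + scale c y" "q \<in> Q"
      by auto
    thus "scale e a \<in> ?Q'"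
      using subspace_scale[OF sub]
      by (intro CollectI exI[of _ "scale e q"] exI[of _ "e * c"]) (auto simp: scale_right_distrib)
  qed
  have br': "bracket a b \<in> Q" if ab: "a \<in> ?Q'" "b \<in> ?Q'" for a b
  proof -
    from ab obtain q c r d where ab: "a = q + scale c y" "b = r + scale d y" "q \<in> Q" "r \<in> Q"
      by auto
    show ?thesis
      unfolding ab(1,2) bracket_add_left bracket_add_right bracket_scale_left bracket_scale_right
      using ab(3,4) br norm norm' sub
      by (auto simp: bracket_self intro!: subspace_add subspace_scale)
  qed
  have F': "pmap a \<in> Q" if a: "a \<in> ?Q'" for a
  proof -
    from a obtain q c where a: "a = q + scale c y" "q \<in> Q"
      by auto
    have "pmap a - (pmap q + pmap (scale c y)) \<in> Q"
      unfolding a(1) using sub a br norm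
      by (intro pmap_add_mod[of Q Q]) (auto simp: bracket_scale_left intro: subspace_scale)
    moreover have "pmap q + pmap (scale c y) \<in> Q"
      using FQ[OF a(2)] Fy sub by (auto simp: pmap_scale intro!: subspace_add subspace_scale)
    ultimately show ?thesis
      using subspace_add[OF sub] by fastforce
  qed
  have nil': "p_nilpotent a" if "a \<in> ?Q'" for a
    using F'[OF that] nilQ p_nilpotent_iff_pmap by blast
  have "y \<in> ?Q'"
    using subspace_0[OF sub] by (intro CollectI exI[of _ 0] exI[of _ 1]) simp
  from nil'[OF this] obtain n where n: "(pmap ^^ n) y = 0"
    unfolding p_nilpotent_def by auto
  have "(bracket y ^^ (CHAR('k) ^ n)) v = 0" for v
    using bracket_funpow_pmap[of n y] n by (metis bracket_zero_left)
  hence "engel ?Q'"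
    using engel_add_line[OF \<open>engel Q\<close> norm subspace_0[OF sub]] by blast
  thus ?thesis
    unfolding p_nil_engel_def restricted_subalgebra_def p_nil_def
    using sub' br' F' Q_sub nil' by auto
qed

text \<open>
  This is Engel's theorem in the restricted setting. A \<open>p\<close>-nil subalgebra \<open>Q \<subseteq> H\<close> with the Engel
  property that does not yet contain \<open>[H, H]\<close> has, by that property applied to \<open>[H, H]\<close> modulo \<open>Q\<close>, an
  element \<open>v \<in> [H, H] - Q\<close> that normalizes it. The last iterate of \<open>v\<close> under the \<open>p\<close>-map outside
  \<open>Q\<close> can be adjoined. Each step enlarges an independent set inside \<open>Q\<close>, so the finite dimension of
  \<open>H\<close> stops the process.
\<close>

lemma exists_p_nil_engel:
  assumes H: "restricted_subalgebra H" "finite_dimensional H"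
    and nil: "p_nil derived_subalgebra"
  obtains Q where "p_nil_engel Q" "Q \<subseteq> H" "\<And>a b. a \<in> H \<Longrightarrow> b \<in> H \<Longrightarrow> bracket a b \<in> Q"
proof -
  have Hsub: "subspace H" and Hbr: "\<And>a b. a \<in> H \<Longrightarrow> b \<in> H \<Longrightarrow> bracket a b \<in> H"
    and HF: "\<And>a. a \<in> H \<Longrightarrow> pmap a \<in> H"
    using H(1) unfolding restricted_subalgebra_def by auto
  define V where "V = span {bracket a b | a b. a \<in> H \<and> b \<in> H}"
  have VH: "V \<subseteq> H"
    unfolding V_def using Hbr by (intro span_minimal[OF _ Hsub]) auto
  have Vnil: "p_nilpotent v" if "v \<in> V" for v
  proof -
    have "V \<subseteq> derived_subalgebra"
      unfolding V_def derived_subalgebra_def by (rule span_mono) auto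
    thus ?thesis using that nil unfolding p_nil_def by auto
  qed
  obtain B where B: "finite B" "span B = H"
    using H(2) unfolding finite_dimensional_def by auto
  \<comment> \<open>The process is recorded by the size \<open>n\<close> of an independent subset of \<open>Q\<close>.\<close>
  have *: "\<exists>Q. p_nil_engel Q \<and> Q \<subseteq> H \<and>
      (V \<subseteq> Q \<or> (\<exists>b\<subseteq>Q. independent b \<and> finite b \<and> card b = n))" for n
  proof (induction n)
    case 0
    have "engel {0}"
      unfolding engel_def using subspace_0 by auto
    hence "p_nil_engel {0}"
      unfolding p_nil_engel_def restricted_subalgebra_def p_nil_def p_nilpotent_def
      by (auto simp: subspace_def)
    moreover have "{0} \<subseteq> H" using subspace_0[OF Hsub] by auto
    moreover have "\<exists>b\<subseteq>{0}. independent b \<and> finite b \<and> card b = 0"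
      by (intro exI[of _ "{}"]) (auto simp: independent_empty)
    ultimately show ?case by blast
  next
    case (Suc n)
    then obtain Q where Q: "p_nil_engel Q" "Q \<subseteq> H"
      and or: "V \<subseteq> Q \<or> (\<exists>b\<subseteq>Q. independent b \<and> finite b \<and> card b = n)"
      by auto
    show ?case
    proof (cases "V \<subseteq> Q")
      case False
      with or obtain b where b: "b \<subseteq> Q" "independent b" "finite b" "card b = n"
        by auto
      have Qsub: "subspace Q" and Qbr: "\<And>a b. a \<in> Q \<Longrightarrow> b \<in> Q \<Longrightarrow> bracket a b \<in> Q"
        and QF: "\<And>a. a \<in> Q \<Longrightarrow> pmap a \<in> Q" and "engel Q"
        using Q(1) unfolding p_nil_engel_def restricted_subalgebra_def by auto
      have QV: "bracket q v \<in> V" if "q \<in> Q" "v \<in> V" for q v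
        using that VH Q(2) unfolding V_def by (blast intro: span_base)
      obtain v where v: "v \<in> V" "v \<notin> Q" "\<And>q. q \<in> Q \<Longrightarrow> bracket q v \<in> Q"
      proof (rule engelD[OF \<open>engel Q\<close> _ Qsub])
        show "subspace V" unfolding V_def by (rule subspace_span)
      qed (use QV Qbr False in auto)
      obtain m where m: "(pmap ^^ m) v = 0"
        using Vnil[OF v(1)] unfolding p_nilpotent_def by auto
      \<comment> \<open>The iterate chosen here may leave \<open>V\<close>, but it stays in \<open>H\<close> and still normalizes \<open>Q\<close>.\<close>
      define i where "i = (LEAST i. (pmap ^^ i) v \<in> Q)"
      have "(pmap ^^ m) v \<in> Q" using m subspace_0[OF Qsub] by simp
      hence i: "(pmap ^^ i) v \<in> Q" unfolding i_def by (rule LeastI)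
      with v(2) obtain j where j: "i = Suc j" by (cases i) auto
      define y where "y = (pmap ^^ j) v"
      have yQ: "y \<notin> Q"
        using not_less_Least[of j "\<lambda>i. (pmap ^^ i) v \<in> Q"] j unfolding i_def y_def by simp
      have FyQ: "pmap y \<in> Q" using i unfolding j y_def by simp
      have yH: "y \<in> H"
        unfolding y_def using v(1) VH by (induction j) (auto intro: HF)
      have vQ: "bracket v q \<in> Q" if "q \<in> Q" for q
        using v(3)[OF that] subspace_neg[OF Qsub] by (subst bracket_flip) auto
      have "(bracket v ^^ t) q \<in> Q" if "q \<in> Q" for t q
        using that by (induction t) (auto intro: vQ)
      hence norm: "bracket y q \<in> Q" if "q \<in> Q" for q
        unfolding y_def bracket_funpow_pmap using that by blast
      let ?Q' = "{q + scale c y | q c. q \<in> Q}"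
      have "p_nil_engel ?Q'"
        by (rule p_nil_engel_add_line[OF Q(1) norm FyQ])
      moreover have "?Q' \<subseteq> H"
        using Q(2) yH Hsub by (auto intro!: subspace_add subspace_scale)
      moreover have "\<exists>b'\<subseteq>?Q'. independent b' \<and> finite b' \<and> card b' = Suc n"
      proof (intro exI[of _ "insert y b"] conjI)
        have nb: "y \<notin> span b"
          using yQ span_minimal[OF b(1) Qsub] by auto
        thus "independent (insert y b)"
          using b(2) by (rule independent_insertI)
        show "finite (insert y b)" using b(3) by simp
        show "card (insert y b) = Suc n"
          using b(3,4) nb span_base by (subst card_insert_disjoint) auto
        have "y \<in> ?Q'" using subspace_0[OF Qsub] by (intro CollectI exI[of _ 0] exI[of _ 1]) simp
        moreover have "q \<in> ?Q'" if "q \<in> Q" for q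
          using that by (intro CollectI exI[of _ q] exI[of _ 0]) simp
        ultimately show "insert y b \<subseteq> ?Q'" using b(1) by blast
      qed
      ultimately show ?thesis by blast
    qed (use Q in blast)
  qed
  obtain Q where Q: "p_nil_engel Q" "Q \<subseteq> H"
    and or: "V \<subseteq> Q \<or> (\<exists>b\<subseteq>Q. independent b \<and> finite b \<and> card b = Suc (card B))"
    using *[of "Suc (card B)"] by auto
  have "V \<subseteq> Q"
  proof (rule ccontr)
    assume "\<not> V \<subseteq> Q"
    with or obtain b where b: "b \<subseteq> Q" "independent b" "card b = Suc (card B)"
      by auto
    hence "card b \<le> card B"
      using independent_span_bound[OF B(1), of b] B(2) Q(2) by auto
    thus False using b by simp
  qed
  hence "bracket a b \<in> Q" if "a \<in> H" "b \<in> H" for a b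
    using that unfolding V_def by (blast intro: span_base)
  with Q that show ?thesis by blast
qed

lemma restricted_subalgebra_hull: "restricted_subalgebra (restricted_subalgebra hull A)"
proof (rule hull_in)
  fix F assume "\<forall>S\<in>F. restricted_subalgebra S"
  thus "restricted_subalgebra (\<Inter>F)"
    unfolding restricted_subalgebra_def by (auto intro: subspace_Inter)
qed

definition p_nilpotents :: "'l set" where
  "p_nilpotents = {x. p_nilpotent x}"

text \<open>
  Only closure under addition is not formal. Modulo a \<open>p\<close>-nil subalgebra \<open>Q\<close> that contains the brackets
  of the finite-dimensional subalgebra generated by \<open>x\<close> and \<open>y\<close>, the \<open>p\<close>-map is additive. Hence a
  high iterate of \<open>x + y\<close> falls into \<open>Q\<close>, where it is \<open>p\<close>-nilpotent.
\<close>

lemma restricted_ideal_p_nilpotents: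
  assumes lf: locally_finite_dimensional and nil: "p_nil derived_subalgebra"
  shows "restricted_ideal p_nilpotents"
proof -
  have add: "p_nilpotent (x + y)" if x: "p_nilpotent x" and y: "p_nilpotent y" for x y
  proof -
    let ?H = "restricted_subalgebra hull {x, y}"
    have H: "restricted_subalgebra ?H"
      by (rule restricted_subalgebra_hull)
    have Hsub: "subspace ?H" and HF: "\<And>a. a \<in> ?H \<Longrightarrow> pmap a \<in> ?H"
      using H unfolding restricted_subalgebra_def by auto
    have xyH: "x \<in> ?H" "y \<in> ?H" by (auto intro: hull_inc)
    have "finite_dimensional ?H"
      using lf unfolding locally_finite_dimensional_def by auto
    from exists_p_nil_engel[OF H this nil]
    obtain Q where Q: "p_nil_engel Q" "Q \<subseteq> ?H"
      and HQ: "\<And>a b. a \<in> ?H \<Longrightarrow> b \<in> ?H \<Longrightarrow> bracket a b \<in> Q"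
      by blast
    have Qsub: "subspace Q" and QF: "\<And>a. a \<in> Q \<Longrightarrow> pmap a \<in> Q" and Qnil: "p_nil Q"
      using Q(1) unfolding p_nil_engel_def restricted_subalgebra_def by auto
    have Fadd: "pmap (a + b) - (pmap a + pmap b) \<in> Q" if "a \<in> ?H" "b \<in> ?H" for a b
      using that HQ Qsub Q(2) by (intro pmap_add_mod[of Q ?H]) auto
    have it: "(pmap ^^ n) (x + y) - ((pmap ^^ n) x + (pmap ^^ n) y) \<in> Q
      \<and> (pmap ^^ n) x \<in> ?H \<and> (pmap ^^ n) y \<in> ?H" for n
    proof (induction n)
      case 0
      thus ?case using subspace_0[OF Qsub] xyH by simp
    next
      case (Suc n)
      let ?a = "(pmap ^^ n) x" and ?b = "(pmap ^^ n) y"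
      define q where "q = (pmap ^^ n) (x + y) - (?a + ?b)"
      have q: "q \<in> Q" and ab: "?a \<in> ?H" "?b \<in> ?H" using Suc.IH unfolding q_def by auto
      have "pmap ((?a + ?b) + q) - (pmap (?a + ?b) + pmap q) \<in> Q"
        using ab q Q(2) Hsub by (intro Fadd) (auto intro: subspace_add)
      moreover have "pmap (?a + ?b) - (pmap ?a + pmap ?b) \<in> Q"
        using ab by (rule Fadd)
      moreover have "pmap q \<in> Q" using q by (rule QF)
      ultimately have "(pmap ((?a + ?b) + q) - (pmap (?a + ?b) + pmap q)) +
          (pmap (?a + ?b) - (pmap ?a + pmap ?b)) + pmap q \<in> Q"
        using Qsub by (intro subspace_add) auto
      moreover have "(?a + ?b) + q = (pmap ^^ n) (x + y)"
        unfolding q_def by simp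
      ultimately show ?case
        using ab HF by (simp add: algebra_simps)
    qed
    obtain n m where nm: "(pmap ^^ n) x = 0" "(pmap ^^ m) y = 0"
      using x y unfolding p_nilpotent_def by auto
    have "(pmap ^^ (n + m)) x = 0"
      using nm by (subst add.commute, subst funpow_add) simp
    moreover have "(pmap ^^ (n + m)) y = 0"
      using nm by (subst funpow_add) simp
    ultimately have "(pmap ^^ (n + m)) (x + y) \<in> Q"
      using it[of "n + m"] by simp
    thus ?thesis
      using Qnil p_nilpotent_iff_funpow_pmap[of "n + m" "x + y"] unfolding p_nil_def by blast
  qed
  have scale: "p_nilpotent (scale c x)" if x: "p_nilpotent x" for c x
  proof -
    obtain n where n: "n \<ge> 1" "(pmap ^^ n) x = 0"
      using x unfolding p_nilpotent_def by auto
    have "(pmap ^^ n) (scale c x) = scale (c ^ (CHAR('k) ^ n)) ((pmap ^^ n) x)"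
      by (induction n) (simp_all add: pmap_scale mult.commute flip: power_mult)
    thus ?thesis using n unfolding p_nilpotent_def by auto
  qed
  have "bracket x y \<in> derived_subalgebra" for x y
    unfolding derived_subalgebra_def by (auto intro: span_base)
  hence br: "p_nilpotent (bracket x y)" for x y
    using nil unfolding p_nil_def by auto
  have "p_nilpotent 0"
    unfolding p_nilpotent_def by auto
  thus ?thesis
    unfolding restricted_ideal_def p_nilpotents_def subspace_def
    using add scale br by (auto simp: p_nilpotent_iff_pmap)
qed

lemma p_nilpotents_subset_O_p:
  assumes "restricted_ideal p_nilpotents"
  shows "p_nilpotents \<subseteq> O_p"
proof -
  have "p_nil p_nilpotents"
    unfolding p_nil_def p_nilpotents_def by simp
  thus ?thesis
    unfolding O_p_def using assms by (intro subsetI span_base) blast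
qed

end

section \<open>Characters of restricted Lie algebras\<close>

context restricted_lie_algebra
begin

lemma span_image_sumE:
  assumes "finite A" "y \<in> span (f ` A)"
  obtains c where "y = (\<Sum>i\<in>A. scale (c i) (f i))"
proof -
  let ?S = "{\<Sum>i\<in>A. scale (c i) (f i) | c. True}"
  have "subspace ?S"
  proof (rule subspaceI)
    show "0 \<in> ?S" by (intro CollectI exI[of _ "\<lambda>_. 0"]) simp
  next
    fix a b assume "a \<in> ?S" "b \<in> ?S"
    then obtain c d where "a = (\<Sum>i\<in>A. scale (c i) (f i))" "b = (\<Sum>i\<in>A. scale (d i) (f i))" by auto
    thus "a + b \<in> ?S"
      by (intro CollectI exI[of _ "\<lambda>i. c i + d i"]) (simp add: sum.distrib scale_left_distrib)
  next
    fix e a assume "a \<in> ?S"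
    then obtain c where "a = (\<Sum>i\<in>A. scale (c i) (f i))" by auto
    thus "scale e a \<in> ?S"
      by (intro CollectI exI[of _ "\<lambda>i. e * c i"]) (simp add: scale_sum_right)
  qed
  moreover have "f ` A \<subseteq> ?S"
  proof
    fix y assume "y \<in> f ` A"
    then obtain j where j: "j \<in> A" "y = f j" by auto
    have "(\<Sum>i\<in>A. scale (if i = j then 1 else 0) (f i)) = (\<Sum>i\<in>A. if i = j then f i else 0)"
      by (intro sum.cong) auto
    also have "\<dots> = y" using j assms(1) by simp
    finally show "y \<in> ?S"
      by (intro CollectI exI[of _ "\<lambda>i. if i = j then 1 else 0"]) simp
  qed
  ultimately have "span (f ` A) \<subseteq> ?S" by (rule span_minimal[rotated])
  thus ?thesis using assms(2) that by auto
qed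

text \<open>
  The iterates of \<open>x\<close> under the \<open>p\<close>-map lie in the restricted subalgebra generated by \<open>x\<close>, which is
  finite-dimensional.
\<close>

lemma pmap_orbit_relation:
  assumes locally_finite_dimensional
  obtains n c where "(pmap ^^ n) x = (\<Sum>i<n. scale (c i) ((pmap ^^ i) x))"
proof -
  let ?H = "restricted_subalgebra hull {x}" and ?f = "\<lambda>i. (pmap ^^ i) x"
  have H: "restricted_subalgebra ?H" by (rule restricted_subalgebra_hull)
  obtain B where B: "finite B" "span B = ?H"
    using assms unfolding locally_finite_dimensional_def finite_dimensional_def by blast
  have fH: "?f i \<in> ?H" for i
    using H by (induction i) (auto simp: restricted_subalgebra_def intro: hull_inc)
  have "\<exists>n. ?f n \<in> span (?f ` {..<n})"
  proof (rule ccontr)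
    assume "\<not> ?thesis"
    hence no: "?f n \<notin> span (?f ` {..<n})" for n by blast
    have "independent (?f ` {..<n}) \<and> card (?f ` {..<n}) = n" for n
    proof (induction n)
      case (Suc n)
      have ins: "?f ` {..<Suc n} = insert (?f n) (?f ` {..<n})"
        by (simp only: lessThan_Suc image_insert)
      have "?f n \<notin> ?f ` {..<n}" using no[of n] by (metis span_base)
      hence "card (insert (?f n) (?f ` {..<n})) = Suc n"
        using Suc.IH by (subst card_insert_disjoint) simp_all
      moreover have "independent (insert (?f n) (?f ` {..<n}))"
        using Suc.IH no[of n] by (intro independent_insertI) simp_all
      ultimately show ?case unfolding ins by blast
    qed (simp add: independent_empty)
    hence "independent (?f ` {..<Suc (card B)})" "card (?f ` {..<Suc (card B)}) = Suc (card B)"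
      by blast+
    moreover have "?f ` {..<Suc (card B)} \<subseteq> span B"
      using fH B(2) by auto
    ultimately show False
      using independent_span_bound[OF B(1)] by force
  qed
  then obtain n where "?f n \<in> span (?f ` {..<n})" by blast
  thus ?thesis
    by (rule span_image_sumE[rotated]) (use that in auto)
qed

text \<open>
  The subspaces \<open>U\<close> for which \<open>L / U\<close> is an abelian restricted Lie algebra. On such a quotient the
  \<open>p\<close>-map is additive and semilinear with respect to the Frobenius map.
\<close>

definition abelian_quotient :: "'l set \<Rightarrow> bool" where
  "abelian_quotient U \<longleftrightarrow> subspace U \<and> (\<forall>x y. bracket x y \<in> U) \<and> (\<forall>x\<in>U. pmap x \<in> U)"

lemma funpow_pmap_mem:
  assumes "abelian_quotient U" "x \<in> U"
  shows "(pmap ^^ n) x \<in> U"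
  using assms by (induction n) (auto simp: abelian_quotient_def)

lemma pmap_add_mod_abelian:
  assumes "abelian_quotient U"
  shows "pmap (x + y) - (pmap x + pmap y) \<in> U"
  using assms by (intro pmap_add_mod[of U UNIV]) (auto simp: abelian_quotient_def)

lemma pmap_sum_mod_abelian:
  assumes U: "abelian_quotient U" and "finite I"
  shows "pmap (\<Sum>i\<in>I. scale (c i) (f i)) - (\<Sum>i\<in>I. scale (c i ^ CHAR('k)) (pmap (f i))) \<in> U"
  using assms(2)
proof (induction I)
  case empty
  thus ?case using U by (simp add: abelian_quotient_def subspace_0)
next
  case (insert j I)
  let ?s = "\<Sum>i\<in>I. scale (c i) (f i)" and ?t = "\<Sum>i\<in>I. scale (c i ^ CHAR('k)) (pmap (f i))"
  have "(pmap (scale (c j) (f j) + ?s) - (pmap (scale (c j) (f j)) + pmap ?s)) + (pmap ?s - ?t) \<in> U"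
    using U pmap_add_mod_abelian[OF U] insert.IH
    by (intro subspace_add) (auto simp: abelian_quotient_def)
  thus ?case using insert.hyps by (simp add: pmap_scale algebra_simps)
qed

text \<open>
  For an abelian quotient \<open>L / U\<close> this says that the \<open>p\<close>-map of \<open>L / U\<close> is injective.
\<close>

definition pmap_radical :: "'l set \<Rightarrow> bool" where
  "pmap_radical U \<longleftrightarrow> (\<forall>x. pmap x \<in> U \<longrightarrow> x \<in> U)"

text \<open>
  This is where the field has to be perfect. Start from a linear relation among the iterates of \<open>x\<close>. As
  long as the coefficient of \<open>x\<close> itself vanishes, the relation is the image under the \<open>p\<close>-map of
  the relation with the \<open>p\<close>-th roots of the coefficients, and injectivity modulo \<open>U\<close> shortens it.
  In the end \<open>x\<close> is, modulo \<open>U\<close>, a combination of its own higher iterates.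
\<close>

lemma pmap_radical_relation:
  assumes root: "\<And>a :: 'k. \<exists>b. b ^ CHAR('k) = a"
    and lf: locally_finite_dimensional and U: "abelian_quotient U" "pmap_radical U"
  obtains n d where "x - (\<Sum>i=1..n. scale (d i) ((pmap ^^ i) x)) \<in> U"
proof -
  have sub: "subspace U" using U(1) by (simp add: abelian_quotient_def)
  let ?f = "\<lambda>i. (pmap ^^ i) x"
  have main: "\<exists>n d. x - (\<Sum>i=1..n. scale (d i) (?f i)) \<in> U"
    if "j \<le> n" "a j \<noteq> 0" "(\<Sum>i\<le>n. scale (a i) (?f i)) \<in> U" for n j and a :: "nat \<Rightarrow> 'k"
    using that
  proof (induction n arbitrary: a j)
    case (0 a j)
    hence "scale (a 0) x \<in> U" "a 0 \<noteq> 0" by auto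
    hence "scale (inverse (a 0)) (scale (a 0) x) \<in> U"
      using sub subspace_scale by blast
    hence "x \<in> U" using \<open>a 0 \<noteq> 0\<close> by simp
    thus ?case by (intro exI[of _ 0]) auto
  next
    case (Suc n a j)
    show ?case
    proof (cases "a 0 = 0")
      case False
      have "scale (inverse (a 0)) (\<Sum>i\<le>Suc n. scale (a i) (?f i)) \<in> U"
        using sub subspace_scale Suc.prems(3) by blast
      also have "(\<Sum>i\<le>Suc n. scale (a i) (?f i)) = scale (a 0) x + (\<Sum>i=1..Suc n. scale (a i) (?f i))"
        by (simp add: sum.atMost_Suc_shift sum.atLeast1_atMost_eq lessThan_Suc_atMost
            del: sum.atMost_Suc sum.lessThan_Suc funpow.simps)
          (simp add: lessThan_Suc_atMost[symmetric] del: funpow.simps)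
      also have "scale (inverse (a 0)) \<dots> =
          x - (\<Sum>i=1..Suc n. scale (- (inverse (a 0) * a i)) (?f i))"
        using False by (simp only: scale_right_distrib scale_sum_right scale_scale)
          (simp add: sum_negf[symmetric] del: sum.cl_ivl_Suc)
      finally show ?thesis
        by - (rule exI[of _ "Suc n"], rule exI[of _ "\<lambda>i. - (inverse (a 0) * a i)"])
    next
      case True
      define b where "b = (\<lambda>i. SOME b. b ^ CHAR('k) = a (Suc i))"
      have b: "b i ^ CHAR('k) = a (Suc i)" for i
        unfolding b_def using root by (rule someI_ex)
      obtain j' where j': "j = Suc j'" using True Suc.prems(2) by (cases j) auto
      have bj: "b j' \<noteq> 0"
        using b[of j'] Suc.prems(2) char_pos unfolding j' by (auto simp: power_0_left)
      let ?s = "\<Sum>i\<le>n. scale (b i) (?f i)"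
      have "pmap ?s - (\<Sum>i\<le>n. scale (b i ^ CHAR('k)) (pmap (?f i))) \<in> U"
        by (rule pmap_sum_mod_abelian[OF U(1)]) simp
      also have "(\<Sum>i\<le>n. scale (b i ^ CHAR('k)) (pmap (?f i))) = (\<Sum>i\<le>Suc n. scale (a i) (?f i))"
        unfolding b using True by (subst sum.atMost_Suc_shift) simp
      finally have "pmap ?s - (\<Sum>i\<le>Suc n. scale (a i) (?f i)) + (\<Sum>i\<le>Suc n. scale (a i) (?f i)) \<in> U"
        using Suc.prems(3) sub by (intro subspace_add) auto
      hence "?s \<in> U"
        using U(2) unfolding pmap_radical_def by simp
      thus ?thesis
        using Suc.IH[of j' b] bj Suc.prems(1) unfolding j' by simp
    qed
  qed
  obtain n c where nc: "?f n = (\<Sum>i<n. scale (c i) (?f i))"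
    by (rule pmap_orbit_relation[OF lf])
  let ?a = "c(n := - 1)"
  have "(\<Sum>i\<le>n. scale (?a i) (?f i)) = (\<Sum>i<n. scale (c i) (?f i)) - ?f n"
    by (simp add: lessThan_Suc_atMost[symmetric])
  also have "\<dots> = 0" using nc by simp
  finally have "(\<Sum>i\<le>n. scale (?a i) (?f i)) \<in> U"
    using subspace_0[OF sub] by simp
  hence "\<exists>n d. x - (\<Sum>i=1..n. scale (d i) (?f i)) \<in> U"
    by (rule main[of n n ?a, rotated 2]) simp_all
  then obtain N d where "x - (\<Sum>i=1..N. scale (d i) (?f i)) \<in> U"
    by (elim exE)
  thus ?thesis by (rule that)
qed

text \<open>
  If \<open>F x \<in> V\<close>, with \<open>F\<close> the \<open>p\<close>-map, then all \<open>F\<^sup>i x\<close> with \<open>i \<ge> 1\<close> lie in \<open>V\<close>, and by the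
  previous relation so does \<open>x\<close>.
\<close>

lemma pmap_radical_mono:
  assumes root: "\<And>a :: 'k. \<exists>b. b ^ CHAR('k) = a"
    and lf: locally_finite_dimensional and U: "abelian_quotient U" "pmap_radical U"
    and V: "abelian_quotient V" "U \<subseteq> V"
  shows "pmap_radical V"
  unfolding pmap_radical_def
proof (intro allI impI)
  fix x assume x: "pmap x \<in> V"
  have sub: "subspace V" using V(1) by (simp add: abelian_quotient_def)
  obtain n d where "x - (\<Sum>i=1..n. scale (d i) ((pmap ^^ i) x)) \<in> U"
    by (rule pmap_radical_relation[OF root lf U])
  hence 1: "x - (\<Sum>i=1..n. scale (d i) ((pmap ^^ i) x)) \<in> V" using V(2) by blast
  have "(pmap ^^ i) x \<in> V" if "i \<ge> 1" for i
  proof -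
    obtain j where "i = Suc j" using \<open>i \<ge> 1\<close> by (cases i) auto
    thus ?thesis
      using funpow_pmap_mem[OF V(1) x, of j] by (simp add: funpow_swap1)
  qed
  hence 2: "(\<Sum>i=1..n. scale (d i) ((pmap ^^ i) x)) \<in> V"
    using sub by (intro subspace_sum subspace_scale) auto
  from subspace_add[OF sub 1 2] show "x \<in> V" by simp
qed

text \<open>
  Exactly the linear maps whose extension to the free algebra annihilates the defining relations of the
  restricted enveloping algebra, that is, its algebra homomorphisms into the algebraic closure.
\<close>

definition character :: "('l \<Rightarrow> 'k alg_closure) \<Rightarrow> bool" where
  "character \<phi> \<longleftrightarrow> (\<forall>x y. \<phi> (x + y) = \<phi> x + \<phi> y) \<and> (\<forall>c x. \<phi> (scale c x) = to_ac c * \<phi> x) \<and>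
     (\<forall>x y. \<phi> (bracket x y) = 0) \<and> (\<forall>x. \<phi> (pmap x) = \<phi> x ^ CHAR('k))"

text \<open>
  The graph of a character on a restricted subalgebra that contains all brackets. Working with graphs makes
  unions of chains immediate; by linearity, single-valuedness reduces to the value at \<open>0\<close>.
\<close>

definition partial_character :: "('l \<times> 'k alg_closure) set \<Rightarrow> bool" where
  "partial_character G \<longleftrightarrow> (\<forall>x y a b. (x, a) \<in> G \<and> (y, b) \<in> G \<longrightarrow> (x + y, a + b) \<in> G) \<and>
     (\<forall>c x a. (x, a) \<in> G \<longrightarrow> (scale c x, to_ac c * a) \<in> G) \<and>
     (\<forall>x y. (bracket x y, 0) \<in> G) \<and> (\<forall>x a. (x, a) \<in> G \<longrightarrow> (pmap x, a ^ CHAR('k)) \<in> G) \<and>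
     (\<forall>b. (0, b) \<in> G \<longrightarrow> b = 0)"

lemma partial_characterD:
  assumes "partial_character G"
  shows "(x, a) \<in> G \<Longrightarrow> (y, b) \<in> G \<Longrightarrow> (x + y, a + b) \<in> G"
    and "(x, a) \<in> G \<Longrightarrow> (scale c x, to_ac c * a) \<in> G"
    and "(bracket x y, 0) \<in> G"
    and "(x, a) \<in> G \<Longrightarrow> (pmap x, a ^ CHAR('k)) \<in> G"
    and "(0, b) \<in> G \<Longrightarrow> b = 0"
    and "(0, 0) \<in> G"
proof -
  show "(x, a) \<in> G \<Longrightarrow> (y, b) \<in> G \<Longrightarrow> (x + y, a + b) \<in> G"
    "(x, a) \<in> G \<Longrightarrow> (scale c x, to_ac c * a) \<in> G"
    "(x, a) \<in> G \<Longrightarrow> (pmap x, a ^ CHAR('k)) \<in> G" "(0, b) \<in> G \<Longrightarrow> b = 0"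
    using assms unfolding partial_character_def by simp_all
  show "(bracket x y, 0) \<in> G" for x y
    using assms unfolding partial_character_def by simp
  from this[of 0 0] show "(0, 0) \<in> G" by simp
qed

lemma partial_character_unique:
  assumes "partial_character G" "(x, a) \<in> G" "(x, b) \<in> G"
  shows "a = b"
proof -
  have "(scale (- 1) x, to_ac (- 1) * b) \<in> G"
    using partial_characterD(2)[OF assms(1,3)] .
  from partial_characterD(1)[OF assms(1,2) this]
  have "(0, a - b) \<in> G" by simp
  from partial_characterD(5)[OF assms(1) this] show ?thesis by simp
qed

text \<open>
  Let \<open>n\<close> be least such that \<open>F\<^sup>n y\<close> lies in the domain plus the span of the earlier iterates, \<open>F\<close>
  being the \<open>p\<close>-map. By minimality \<open>y, \<dots>, F\<^sup>n\<^sup>-\<^sup>1 y\<close> are independent modulo the domain, so any \<open>z\<close> gives a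
  well-defined linear extension with \<open>F\<^sup>i y \<mapsto> z\<close> raised to \<open>p\<^sup>i\<close>. The equation for \<open>z\<close> is exactly
  the compatibility with the \<open>p\<close>-map at the last iterate.
\<close>

lemma partial_character_extend:
  assumes G: "partial_character G" and wb: "(w, b) \<in> G"
    and rel: "(pmap ^^ n) y = w + (\<Sum>i<n. scale (c i) ((pmap ^^ i) y))"
    and min: "\<And>j w a. j < n \<Longrightarrow> w \<in> Domain G \<Longrightarrow>
      (pmap ^^ j) y \<noteq> w + (\<Sum>i<j. scale (a i) ((pmap ^^ i) y))"
    and z: "z ^ (CHAR('k) ^ n) = b + (\<Sum>i<n. to_ac (c i) * z ^ (CHAR('k) ^ i))"
    and n: "n > 0"
  obtains G' where "partial_character G'" "G \<subseteq> G'" "(y, z) \<in> G'"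
proof -
  note Gd = partial_characterD[OF G]
  let ?f = "\<lambda>i. (pmap ^^ i) y" and ?z = "\<lambda>i. z ^ (CHAR('k) ^ i)"
  define G' where "G' = {(w + (\<Sum>i<n. scale (a i) (?f i)), b + (\<Sum>i<n. to_ac (a i) * ?z i)) | w b a.
    (w, b) \<in> G}"
  have G'I: "(x, e) \<in> G'" if "(w, b) \<in> G" "x = w + (\<Sum>i<n. scale (a i) (?f i))"
    "e = b + (\<Sum>i<n. to_ac (a i) * ?z i)" for x e w b a
    using that unfolding G'_def by blast
  have G'E: "\<exists>w b a. (w, b) \<in> G \<and> x = w + (\<Sum>i<n. scale (a i) (?f i)) \<and>
    e = b + (\<Sum>i<n. to_ac (a i) * ?z i)" if "(x, e) \<in> G'" for x e
    using that unfolding G'_def by auto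
  have GG': "G \<subseteq> G'"
  proof (rule subrelI)
    fix x e assume "(x, e) \<in> G"
    thus "(x, e) \<in> G'" by (rule G'I[of _ _ _ "\<lambda>_. 0"]) auto
  qed
  have add: "(x + x', e + e') \<in> G'" if xe: "(x, e) \<in> G'" "(x', e') \<in> G'" for x x' e e'
  proof -
    obtain w b a where 1: "(w, b) \<in> G" "x = w + (\<Sum>i<n. scale (a i) (?f i))"
      "e = b + (\<Sum>i<n. to_ac (a i) * ?z i)" using G'E[OF xe(1)] by auto
    obtain w' b' a' where 2: "(w', b') \<in> G" "x' = w' + (\<Sum>i<n. scale (a' i) (?f i))"
      "e' = b' + (\<Sum>i<n. to_ac (a' i) * ?z i)" using G'E[OF xe(2)] by auto
    show ?thesis
      by (rule G'I[OF Gd(1)[OF 1(1) 2(1)], of _ "\<lambda>i. a i + a' i"])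
        (simp_all add: 1 2 sum.distrib scale_left_distrib algebra_simps)
  qed
  have scale: "(scale d x, to_ac d * e) \<in> G'" if xe: "(x, e) \<in> G'" for x e d
  proof -
    obtain w b a where 1: "(w, b) \<in> G" "x = w + (\<Sum>i<n. scale (a i) (?f i))"
      "e = b + (\<Sum>i<n. to_ac (a i) * ?z i)" using G'E[OF xe] by auto
    show ?thesis
      by (rule G'I[OF Gd(2)[OF 1(1)], of _ d "\<lambda>i. d * a i"])
        (simp_all add: 1 scale_right_distrib scale_sum_right sum_distrib_left algebra_simps)
  qed
  have sum: "(\<Sum>i\<in>I. scale (a i) (f i), \<Sum>i\<in>I. to_ac (a i) * g i) \<in> G'"
    if "finite I" "\<And>i. i \<in> I \<Longrightarrow> (f i, g i) \<in> G'" for I :: "nat set" and a f g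
    using that
  proof (induction I)
    case empty
    thus ?case using Gd(6) GG' by auto
  next
    case (insert j I)
    thus ?case using add[OF scale[of "f j" "g j" "a j"]] by auto
  qed
  have orbit: "(?f i, ?z i) \<in> G'" if "i \<le> n" for i
  proof (cases "i < n")
    case True
    have "scale (if j = i then 1 else 0) (?f j) = (if j = i then ?f j else 0)"
      "to_ac (if j = i then 1 else 0) * ?z j = (if j = i then ?z j else 0)" for j
      by auto
    thus ?thesis
      using True by (intro G'I[OF Gd(6), of _ "\<lambda>j. if j = i then 1 else 0"]) simp_all
  next
    case False
    hence "i = n" using that by simp
    thus ?thesis
      using rel z by (intro G'I[OF wb]) simp_all
  qed
  \<comment> \<open>The \<open>p\<close>-map is additive up to brackets, and these have value \<open>0\<close>.\<close>
  have U0: "abelian_quotient {x. (x, 0) \<in> G}"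
    unfolding abelian_quotient_def
  proof (intro conjI ballI allI subspaceI)
    show "pmap x \<in> {x. (x, 0) \<in> G}" if "x \<in> {x. (x, 0) \<in> G}" for x
      using Gd(4)[of x 0] that char_pos by (simp add: power_0_left)
    show "scale c x \<in> {x. (x, 0) \<in> G}" if "x \<in> {x. (x, 0) \<in> G}" for c x
      using Gd(2)[of x 0] that by simp
    show "x + y \<in> {x. (x, 0) \<in> G}" if "x \<in> {x. (x, 0) \<in> G}" "y \<in> {x. (x, 0) \<in> G}" for x y
      using Gd(1)[of x 0 y 0] that by simp
  qed (use Gd(3,6) in auto)
  have pmap: "(pmap x, e ^ CHAR('k)) \<in> G'" if xe: "(x, e) \<in> G'" for x e
  proof -
    obtain w b a where 1: "(w, b) \<in> G" "x = w + (\<Sum>i<n. scale (a i) (?f i))"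
      "e = b + (\<Sum>i<n. to_ac (a i) * ?z i)" using G'E[OF xe] by auto
    let ?s = "\<Sum>i<n. scale (a i) (?f i)"
      and ?t = "\<Sum>i<n. scale (a i ^ CHAR('k)) (?f (Suc i))"
      and ?u = "\<Sum>i<n. to_ac (a i ^ CHAR('k)) * ?z (Suc i)"
    have prime: "prime CHAR('k alg_closure)" using prime_char by simp
    have "pmap ?s - ?t \<in> {x. (x, 0) \<in> G}"
      using pmap_sum_mod_abelian[OF U0, of "{..<n}" a ?f] by simp
    hence l2: "(pmap ?s - ?t, 0) \<in> G'" using GG' by auto
    have l1: "(pmap (w + ?s) - (pmap w + pmap ?s), 0) \<in> G'"
      using pmap_add_mod_abelian[OF U0, of w ?s] GG' by auto
    have tu: "(?t, ?u) \<in> G'"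
    proof (rule sum)
      show "(?f (Suc i), ?z (Suc i)) \<in> G'" if "i \<in> {..<n}" for i
        using that by (intro orbit) simp
    qed simp
    have Fw: "(pmap w, b ^ CHAR('k)) \<in> G'" using Gd(4)[OF 1(1)] GG' by auto
    have "((pmap (w + ?s) - (pmap w + pmap ?s)) + (pmap ?s - ?t) + (?t + pmap w),
        0 + 0 + (?u + b ^ CHAR('k))) \<in> G'"
      by (intro add l1 l2 tu Fw)
    moreover have "(pmap (w + ?s) - (pmap w + pmap ?s)) + (pmap ?s - ?t) + (?t + pmap w) = pmap x"
      unfolding 1(2) by (simp add: algebra_simps)
    moreover have "e ^ CHAR('k) = 0 + 0 + (?u + b ^ CHAR('k))"
    proof -
      have "e ^ CHAR('k) = b ^ CHAR('k) + (\<Sum>i<n. to_ac (a i) * ?z i) ^ CHAR('k)"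
        unfolding 1(3) by (rule freshmans_dream[OF prime]) simp
      also have "(\<Sum>i<n. to_ac (a i) * ?z i) ^ CHAR('k) = (\<Sum>i<n. (to_ac (a i) * ?z i) ^ CHAR('k))"
        by (rule freshmans_dream_sum[OF prime]) simp
      also have "\<dots> = ?u"
        by (intro sum.cong refl) (simp add: power_mult_distrib mult.commute flip: power_mult)
      finally show ?thesis by simp
    qed
    ultimately show ?thesis by simp
  qed
  have single: "e = 0" if "(0, e) \<in> G'" for e
  proof -
    obtain w b a where 1: "(w, b) \<in> G" "0 = w + (\<Sum>i<n. scale (a i) (?f i))"
      "e = b + (\<Sum>i<n. to_ac (a i) * ?z i)" using G'E[OF \<open>(0, e) \<in> G'\<close>] by auto
    have a0: "a i = 0" if "i < n" for i
    proof (rule ccontr)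
      assume "a i \<noteq> 0"
      define N where "N = {i. i < n \<and> a i \<noteq> 0}"
      have N: "finite N" "N \<noteq> {}" unfolding N_def using \<open>i < n\<close> \<open>a i \<noteq> 0\<close> by auto
      define j where "j = Max N"
      have j: "j < n" "a j \<noteq> 0" using Max_in[OF N] unfolding j_def N_def by auto
      have above: "a i = 0" if "j < i" "i < n" for i
        using Max_ge[OF N(1), of i] that unfolding j_def N_def by fastforce
      have "(\<Sum>i<n. scale (a i) (?f i)) = (\<Sum>i<Suc j. scale (a i) (?f i))"
        using j(1) above by (intro sum.mono_neutral_right) auto
      hence "scale (a j) (?f j) = - w - (\<Sum>i<j. scale (a i) (?f i))"
        using 1(2) by (simp add: algebra_simps eq_neg_iff_add_eq_0)
      hence "scale (inverse (a j)) (scale (a j) (?f j)) =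
          scale (inverse (a j)) (- w - (\<Sum>i<j. scale (a i) (?f i)))"
        by simp
      hence "?f j = scale (- inverse (a j)) w + (\<Sum>i<j. scale (- inverse (a j) * a i) (?f i))"
        using j(2) by (simp add: scale_right_diff_distrib scale_sum_right sum_negf)
      moreover have "scale (- inverse (a j)) w \<in> Domain G"
        using Gd(2)[OF 1(1)] by blast
      ultimately show False
        using min[OF j(1), of "scale (- inverse (a j)) w" "\<lambda>i. - inverse (a j) * a i"] by blast
    qed
    hence "w = 0" using 1(2) by simp
    hence "b = 0" using Gd(5) 1(1) by simp
    thus ?thesis using 1(3) a0 by simp
  qed
  have "partial_character G'"
    unfolding partial_character_def using add scale pmap single Gd(3) GG' by blast
  moreover have "(y, z) \<in> G'" using orbit[of 0] by simp
  ultimately show ?thesis by (rule that[OF _ GG'])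
qed

lemma minimal_orbit_relation:
  assumes lf: locally_finite_dimensional and "0 \<in> D" and "y \<notin> D"
  obtains n w c where "n > 0" "w \<in> D" "(pmap ^^ n) y = w + (\<Sum>i<n. scale (c i) ((pmap ^^ i) y))"
    "\<And>j w a. j < n \<Longrightarrow> w \<in> D \<Longrightarrow> (pmap ^^ j) y \<noteq> w + (\<Sum>i<j. scale (a i) ((pmap ^^ i) y))"
proof -
  let ?P = "\<lambda>n. \<exists>w\<in>D. \<exists>c. (pmap ^^ n) y = w + (\<Sum>i<n. scale (c i) ((pmap ^^ i) y))"
  obtain n c where "(pmap ^^ n) y = (\<Sum>i<n. scale (c i) ((pmap ^^ i) y))"
    by (rule pmap_orbit_relation[OF lf])
  hence "?P n" using \<open>0 \<in> D\<close> by (intro bexI[of _ 0]) auto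
  hence P: "?P (LEAST n. ?P n)" by (rule LeastI)
  define m where "m = (LEAST n. ?P n)"
  obtain w c where wc: "w \<in> D" "(pmap ^^ m) y = w + (\<Sum>i<m. scale (c i) ((pmap ^^ i) y))"
    using P unfolding m_def by blast
  have "m > 0"
    using wc assms(3) by (cases m) auto
  moreover have "\<not> ?P j" if "j < m" for j
    using that unfolding m_def by (rule not_less_Least)
  ultimately show ?thesis
    using wc by (intro that[of m w c]) blast+
qed

lemma partial_character_Union:
  assumes "\<C> \<noteq> {}" and pc: "\<And>G. G \<in> \<C> \<Longrightarrow> partial_character G"
    and chain: "\<And>G H. G \<in> \<C> \<Longrightarrow> H \<in> \<C> \<Longrightarrow> G \<subseteq> H \<or> H \<subseteq> G"
  shows "partial_character (\<Union>\<C>)"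
  unfolding partial_character_def
proof (intro conjI allI impI)
  fix x y a b assume "(x, a) \<in> \<Union>\<C> \<and> (y, b) \<in> \<Union>\<C>"
  then obtain G H where "(x, a) \<in> G" "(y, b) \<in> H" "G \<in> \<C>" "H \<in> \<C>" by auto
  thus "(x + y, a + b) \<in> \<Union>\<C>"
    using chain[of G H] partial_characterD(1)[OF pc] by (metis UnionI subsetD)
next
  show "(scale c x, to_ac c * a) \<in> \<Union>\<C>" if "(x, a) \<in> \<Union>\<C>" for c x a
    using that partial_characterD(2)[OF pc] by (meson UnionE UnionI)
  show "(bracket x y, 0) \<in> \<Union>\<C>" for x y
    using assms(1) partial_characterD(3)[OF pc] by blast
  show "(pmap x, a ^ CHAR('k)) \<in> \<Union>\<C>" if "(x, a) \<in> \<Union>\<C>" for x a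
    using that partial_characterD(4)[OF pc] by (meson UnionE UnionI)
  show "b = 0" if "(0, b) \<in> \<Union>\<C>" for b
    using that partial_characterD(5)[OF pc] by (meson UnionE)
qed

text \<open>
  Extend the zero map on \<open>V\<close> first to the iterates of \<open>x\<close>, with a nonzero value at \<open>x\<close>, and then to
  everything by Zorn's lemma. Each extension solves a polynomial equation in the algebraic closure. The
  first one has a nonzero solution because otherwise an iterate of \<open>x\<close>, and hence \<open>x\<close>, would lie in
  \<open>V\<close>.
\<close>

theorem exists_character:
  assumes lf: locally_finite_dimensional and V: "abelian_quotient V" "pmap_radical V"
    and x: "x \<notin> V"
  obtains \<phi> where "character \<phi>" "\<And>v. v \<in> V \<Longrightarrow> \<phi> v = 0" "\<phi> x \<noteq> 0"
proof -
  have p: "CHAR('k) > 1" using prime_char prime_gt_1_nat by blast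
  have sub: "subspace V" using V(1) by (simp add: abelian_quotient_def)
  let ?G0 = "V \<times> {0 :: 'k alg_closure}"
  have G0: "partial_character ?G0"
    using V(1) char_pos unfolding partial_character_def abelian_quotient_def
    by (auto simp: subspace_add subspace_scale power_0_left)
  have dom: "Domain ?G0 = V" by auto
  obtain n w c where n: "n > 0" "w \<in> V" "(pmap ^^ n) x = w + (\<Sum>i<n. scale (c i) ((pmap ^^ i) x))"
    and min: "\<And>j w a. j < n \<Longrightarrow> w \<in> V \<Longrightarrow> (pmap ^^ j) x \<noteq> w + (\<Sum>i<j. scale (a i) ((pmap ^^ i) x))"
    by (rule minimal_orbit_relation[OF lf subspace_0[OF sub] x]) blast
  have "\<exists>j<n. c j \<noteq> 0"
  proof (rule ccontr)
    assume "\<not> ?thesis"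
    hence "(pmap ^^ n) x \<in> V" using n(2,3) by simp
    hence "x \<in> V"
      by (induction n) (use V(2) in \<open>auto simp: pmap_radical_def\<close>)
    thus False using x by simp
  qed
  then obtain z :: "'k alg_closure" where z: "z \<noteq> 0"
    "z ^ (CHAR('k) ^ n) = (\<Sum>i<n. to_ac (c i) * z ^ (CHAR('k) ^ i))"
    using additive_equation_nonzero_root[OF p, of _ n "\<lambda>i. to_ac (c i)"] by auto
  obtain G1 where G1: "partial_character G1" "?G0 \<subseteq> G1" "(x, z) \<in> G1"
  proof (rule partial_character_extend[OF G0 _ n(3) _ _ n(1)])
    show "(w, 0) \<in> ?G0" using n(2) by simp
  qed (use min dom z in auto)
  define A where "A = {G. partial_character G \<and> G1 \<subseteq> G}"
  have "\<exists>M\<in>A. \<forall>N\<in>A. M \<subseteq> N \<longrightarrow> N = M"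
  proof (rule subset_Zorn_nonempty)
    show "A \<noteq> {}" using G1(1) unfolding A_def by auto
    fix \<C> assume C: "\<C> \<noteq> {}" "subset.chain A \<C>"
    have "partial_character (\<Union>\<C>)"
      using C by (intro partial_character_Union) (auto simp: subset_chain_def A_def)
    moreover have "G1 \<subseteq> \<Union>\<C>"
      using C unfolding subset_chain_def A_def by blast
    ultimately show "\<Union>\<C> \<in> A" unfolding A_def by blast
  qed
  then obtain M where MA: "M \<in> A" and MN: "\<forall>N\<in>A. M \<subseteq> N \<longrightarrow> N = M"
    by (rule bexE)
  have M: "partial_character M" "G1 \<subseteq> M" using MA unfolding A_def by simp_all
  have max: "N = M" if "partial_character N" "M \<subseteq> N" for N
  proof -
    have "N \<in> A" unfolding A_def using that M(2) by simp
    thus ?thesis using MN that(2) by simp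
  qed
  have total: "y \<in> Domain M" for y
  proof (rule ccontr)
    assume y: "y \<notin> Domain M"
    have 0: "0 \<in> Domain M" using partial_characterD(6)[OF M(1)] by auto
    obtain n w c where n: "n > 0" "w \<in> Domain M"
        "(pmap ^^ n) y = w + (\<Sum>i<n. scale (c i) ((pmap ^^ i) y))"
      and min: "\<And>j w a. j < n \<Longrightarrow> w \<in> Domain M \<Longrightarrow>
        (pmap ^^ j) y \<noteq> w + (\<Sum>i<j. scale (a i) ((pmap ^^ i) y))"
      by (rule minimal_orbit_relation[OF lf 0 y]) blast
    from n(2) obtain b where b: "(w, b) \<in> M" by auto
    obtain u :: "'k alg_closure" where u:
      "u ^ (CHAR('k) ^ n) = b + (\<Sum>i<n. to_ac (c i) * u ^ (CHAR('k) ^ i))"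
      using additive_equation_root[OF p, of n b "\<lambda>i. to_ac (c i)"] by (rule exE)
    obtain N where N: "partial_character N" "M \<subseteq> N" "(y, u) \<in> N"
      by (rule partial_character_extend[OF M(1) b n(3) min u n(1)])
    from max[OF N(1,2)] N(3) y show False by auto
  qed
  define \<phi> where "\<phi> y = (SOME a. (y, a) \<in> M)" for y
  have \<phi>: "(y, \<phi> y) \<in> M" for y
    unfolding \<phi>_def using total[of y] by (auto intro: someI_ex)
  have \<phi>_eq: "\<phi> y = a" if "(y, a) \<in> M" for y a
    using partial_character_unique[OF M(1) \<phi> that] .
  note Md = partial_characterD[OF M(1)]
  have "character \<phi>"
    unfolding character_def by (intro conjI allI \<phi>_eq Md(1-4) \<phi>)
  moreover have "\<phi> v = 0" if "v \<in> V" for v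
    using that G1(2) M(2) by (intro \<phi>_eq) auto
  moreover have "\<phi> x \<noteq> 0"
    using \<phi>_eq[of x z] G1(3) M(2) z(1) by auto
  ultimately show ?thesis by (rule that)
qed

end

section \<open>Evaluation of the free algebra at a character\<close>

text \<open>
  The algebra homomorphism from the free algebra that extends \<open>\<phi>\<close>.
\<close>

definition free_eval :: "('a \<Rightarrow> 'k::field alg_closure) \<Rightarrow> ('a free_word \<Rightarrow>\<^sub>0 'k) \<Rightarrow> 'k alg_closure" where
  "free_eval \<phi> f = (\<Sum>w\<in>Poly_Mapping.keys f.
     to_ac (Poly_Mapping.lookup f w) * prod_list (map \<phi> (letters w)))"

lemma free_eval_0 [simp]: "free_eval \<phi> 0 = 0"
  by (simp add: free_eval_def)

lemma free_eval_add [simp]: "free_eval \<phi> (f + g) = free_eval \<phi> f + free_eval \<phi> g"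
  unfolding free_eval_def by (rule setsum_keys_plus_distrib) (simp_all add: algebra_simps)

lemma free_eval_minus [simp]: "free_eval \<phi> (- f) = - free_eval \<phi> f"
  using free_eval_add[of \<phi> f "- f"] by (simp add: eq_neg_iff_add_eq_0 add.commute)

lemma free_eval_diff [simp]: "free_eval \<phi> (f - g) = free_eval \<phi> f - free_eval \<phi> g"
  using free_eval_add[of \<phi> f "- g"] by simp

lemma free_eval_sum: "free_eval \<phi> (\<Sum>i\<in>I. f i) = (\<Sum>i\<in>I. free_eval \<phi> (f i))"
  by (induction I rule: infinite_finite_induct) auto

lemma free_eval_single:
  "free_eval \<phi> (Poly_Mapping.single w c) = to_ac c * prod_list (map \<phi> (letters w))"
  by (simp add: free_eval_def)

lemma poly_mapping_eq_sum_single: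
  "f = (\<Sum>w\<in>Poly_Mapping.keys f. Poly_Mapping.single w (Poly_Mapping.lookup f w))"
proof (rule poly_mapping_eqI)
  fix v
  have "(\<Sum>w\<in>Poly_Mapping.keys f. Poly_Mapping.lookup f w when w = v) =
      (\<Sum>w\<in>Poly_Mapping.keys f. if w = v then Poly_Mapping.lookup f w else 0)"
    by (intro sum.cong) (auto simp: when_def)
  also have "\<dots> = Poly_Mapping.lookup f v"
    by (simp add: in_keys_iff)
  finally show "Poly_Mapping.lookup f v = Poly_Mapping.lookup
      (\<Sum>w\<in>Poly_Mapping.keys f. Poly_Mapping.single w (Poly_Mapping.lookup f w)) v"
    by (simp add: lookup_sum lookup_single)
qed

lemma free_eval_mult [simp]: "free_eval \<phi> (f * g) = free_eval \<phi> f * free_eval \<phi> g"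
proof -
  let ?l = "Poly_Mapping.lookup" and ?s = "Poly_Mapping.single" and ?k = "Poly_Mapping.keys"
  let ?v = "\<lambda>w. prod_list (map \<phi> (letters w))"
  have "f * g = (\<Sum>v\<in>?k f. ?s v (?l f v)) * (\<Sum>w\<in>?k g. ?s w (?l g w))"
    by (simp flip: poly_mapping_eq_sum_single)
  also have "\<dots> = (\<Sum>v\<in>?k f. \<Sum>w\<in>?k g. ?s (v + w) (?l f v * ?l g w))"
    by (simp add: sum_product mult_single)
  finally have "free_eval \<phi> (f * g) =
      (\<Sum>v\<in>?k f. \<Sum>w\<in>?k g. to_ac (?l f v * ?l g w) * ?v (v + w))"
    by (simp add: free_eval_sum free_eval_single)
  also have "\<dots> = (\<Sum>v\<in>?k f. \<Sum>w\<in>?k g. (to_ac (?l f v) * ?v v) * (to_ac (?l g w) * ?v w))"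
    by (intro sum.cong refl) (simp add: plus_free_word_def mult_ac)
  also have "\<dots> = free_eval \<phi> f * free_eval \<phi> g"
    unfolding free_eval_def by (simp add: sum_product)
  finally show ?thesis .
qed

lemma free_eval_gen [simp]: "free_eval \<phi> (free_gen x) = \<phi> x"
  by (simp add: free_gen_def free_eval_single)

lemma free_eval_const [simp]: "free_eval \<phi> (free_const c) = to_ac c"
  by (simp add: free_const_def free_eval_single zero_free_word_def)

lemma free_eval_1 [simp]: "free_eval \<phi> 1 = 1"
  using free_eval_const[of \<phi> 1] by (simp add: free_const_def)

lemma free_eval_power [simp]: "free_eval \<phi> (f ^ n) = free_eval \<phi> f ^ n"
  by (induction n) auto

lemma exists_polynomial_inverse:
  fixes x :: "'k::field alg_closure"
  assumes "x \<noteq> 0"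
  obtains h :: "'k poly" where "poly (map_poly to_ac h) x * x = 1"
proof -
  obtain g :: "'k poly" where g: "g \<noteq> 0" "poly (map_poly to_ac g) x = 0"
    and min: "\<And>h. poly (map_poly to_ac h) x = 0 \<Longrightarrow> g dvd h"
    using exists_minimal_polynomial[of x] by blast
  obtain c g' where g': "g = pCons c g'" by (cases g)
  have eq: "to_ac c + x * poly (map_poly to_ac g') x = 0"
    using g(2) unfolding g' by (simp add: map_poly_pCons)
  have "c \<noteq> 0"
  proof
    assume "c = 0"
    hence "poly (map_poly to_ac g') x = 0" using eq assms by simp
    hence "g dvd g'" by (rule min)
    moreover have "g' \<noteq> 0" using g(1) \<open>c = 0\<close> unfolding g' by auto
    ultimately have "degree g \<le> degree g'" by (rule dvd_imp_degree_le)
    thus False using \<open>g' \<noteq> 0\<close> unfolding g' by simp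
  qed
  have smult: "map_poly to_ac (smult (- inverse c) g') = smult (- inverse (to_ac c)) (map_poly to_ac g')"
    by (rule poly_eqI) (simp add: coeff_map_poly)
  have xg': "x * poly (map_poly to_ac g') x = - to_ac c"
    using eq by (simp add: eq_neg_iff_add_eq_0 add.commute)
  have "poly (map_poly to_ac (smult (- inverse c) g')) x * x =
      - inverse (to_ac c) * (x * poly (map_poly to_ac g') x)"
    unfolding smult by (simp add: mult_ac)
  also have "\<dots> = 1" using \<open>c \<noteq> 0\<close> by (simp add: xg')
  finally have "poly (map_poly to_ac (smult (- inverse c) g')) x * x = 1" .
  thus ?thesis by (rule that)
qed

lemma ring_of_type_algebra_simps [simp]:
  "carrier ring_of_type_algebra = UNIV"
  "x \<otimes>\<^bsub>ring_of_type_algebra\<^esub> y = x * y" "x \<oplus>\<^bsub>ring_of_type_algebra\<^esub> y = x + y"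
  "\<one>\<^bsub>ring_of_type_algebra\<^esub> = 1" "\<zero>\<^bsub>ring_of_type_algebra\<^esub> = 0"
  by (simp_all add: ring_of_type_algebra_def)

text \<open>
  The image of the free algebra consists of elements algebraic over the ground field, so it is a field: an
  inverse of \<open>a \<noteq> 0\<close> is a polynomial in \<open>a\<close>.
\<close>

lemma maximal_left_ideal_free_eval_kernel:
  "maximal_left_ideal {f. free_eval \<phi> f = 0} ring_of_type_algebra"
proof -
  let ?R = "ring_of_type_algebra :: ('a free_word \<Rightarrow>\<^sub>0 'k::field) ring"
  let ?M = "{f. free_eval \<phi> f = 0}"
  interpret R: ring ?R by (rule ring_ring_of_type_algebra)
  have M: "left_ideal ?M ?R"
    by (rule R.left_idealI) auto
  show ?thesis
    unfolding maximal_left_ideal_def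
  proof (intro conjI allI impI M; (elim conjE)?)
    have "1 \<notin> ?M" by simp
    thus "?M \<noteq> carrier ?R" by (metis UNIV_I ring_of_type_algebra_simps(1))
    fix I assume I: "left_ideal I ?R" "?M \<subseteq> I"
    note Id = R.left_idealD[OF I(1)]
    show "I = ?M \<or> I = carrier ?R"
    proof (cases "I \<subseteq> ?M")
      case False
      then obtain r where r: "r \<in> I" "free_eval \<phi> r \<noteq> 0" by auto
      obtain h where h: "poly (map_poly to_ac h) (free_eval \<phi> r) * free_eval \<phi> r = 1"
        by (rule exists_polynomial_inverse[OF r(2)])
      define s where "s = (\<Sum>i\<le>degree h. free_const (coeff h i) * r ^ i)"
      have "free_eval \<phi> s = poly (map_poly to_ac h) (free_eval \<phi> r)"
        by (simp add: s_def free_eval_sum poly_altdef coeff_map_poly degree_map_poly)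
      hence "1 - s * r \<in> ?M" using h by simp
      hence "1 - s * r \<in> I" using I(2) by blast
      moreover have "s * r \<in> I" using Id(4)[of s r] r(1) by simp
      ultimately have "(1 - s * r) + s * r \<in> I" using Id(3) by fastforce
      hence "\<one>\<^bsub>?R\<^esub> \<in> I" by simp
      thus ?thesis using R.left_ideal_one_imp_carrier[OF I(1)] by blast
    qed (use I(2) in blast)
  qed
qed

section \<open>Finite codimension of the p-nilpotent elements\<close>

context restricted_lie_algebra
begin

lemma character_funpow_pmap:
  assumes "character \<phi>"
  shows "\<phi> ((pmap ^^ n) x) = \<phi> x ^ (CHAR('k) ^ n)"
  using assms by (induction n) (auto simp: character_def mult.commute simp flip: power_mult)

lemma character_zero:
  assumes "character \<phi>"
  shows "\<phi> 0 = 0"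
proof -
  have "\<phi> (bracket 0 0) = 0" using assms unfolding character_def by blast
  thus ?thesis by simp
qed

lemma character_p_nilpotent:
  assumes \<phi>: "character \<phi>" and "p_nilpotent x"
  shows "\<phi> x = 0"
proof -
  obtain n where "(pmap ^^ n) x = 0"
    using assms(2) unfolding p_nilpotent_def by auto
  hence "\<phi> x ^ (CHAR('k) ^ n) = 0"
    using character_funpow_pmap[OF \<phi>, of n x] character_zero[OF \<phi>] by simp
  thus ?thesis by simp
qed

lemma character_sum:
  assumes \<phi>: "character \<phi>"
  shows "\<phi> (\<Sum>i\<in>I. scale (c i) (f i)) = (\<Sum>i\<in>I. to_ac (c i) * \<phi> (f i))"
  by (induction I rule: infinite_finite_induct)
    (use \<phi> character_zero[OF \<phi>] in \<open>auto simp: character_def\<close>)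

lemma enveloping_ideal_subset_kernel:
  assumes \<phi>: "character \<phi>"
  shows "genideal ring_of_type_algebra enveloping_relations \<subseteq> {f. free_eval \<phi> f = 0}"
proof -
  let ?R = "ring_of_type_algebra :: ('l free_word \<Rightarrow>\<^sub>0 'k) ring"
  let ?M = "{f. free_eval \<phi> f = 0}"
  interpret R: ring ?R by (rule ring_ring_of_type_algebra)
  have "left_ideal ?M ?R" by (rule R.left_idealI) auto
  hence "ideal ?M ?R"
    unfolding left_ideal_def by (intro idealI R.ring_axioms) (auto simp: additive_subgroup_def)
  moreover have "enveloping_relations \<subseteq> ?M"
    using \<phi> unfolding enveloping_relations_def character_def by auto
  ultimately show ?thesis by (rule R.genideal_minimal)
qed

text \<open>
  For a character \<open>\<phi>\<close> the relation \<open>x = \<Sum>d\<^sub>i F\<^sup>i x\<close> modulo \<open>p\<close>-nilpotent elements, \<open>F\<close> being the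
  \<open>p\<close>-map, becomes \<open>\<phi>(x) = \<phi>(x) \<phi>(e)\<close>, where \<open>e\<close> is obtained by dividing the right-hand side by \<open>x\<close> in the
  free algebra. All exponents \<open>p\<^sup>i - 1\<close> in \<open>e\<close> are positive, so \<open>\<phi>(e)\<close> vanishes together with \<open>\<phi>(x)\<close>.
\<close>

lemma exists_support_idempotent:
  assumes root: "\<And>a :: 'k. \<exists>b. b ^ CHAR('k) = a"
    and lf: locally_finite_dimensional
    and P: "abelian_quotient p_nilpotents" "pmap_radical p_nilpotents"
  obtains e :: "'l free_word \<Rightarrow>\<^sub>0 'k"
  where "\<And>\<phi>. character \<phi> \<Longrightarrow> free_eval \<phi> e = (if \<phi> x = 0 then 0 else 1)"
proof -
  obtain n d where nd: "x - (\<Sum>i=1..n. scale (d i) ((pmap ^^ i) x)) \<in> p_nilpotents"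
    by (rule pmap_radical_relation[OF root lf P])
  define e :: "'l free_word \<Rightarrow>\<^sub>0 'k"
    where "e = (\<Sum>i=1..n. free_const (d i) * free_gen x ^ (CHAR('k) ^ i - 1))"
  have "free_eval \<phi> e = (if \<phi> x = 0 then 0 else 1)" if \<phi>: "character \<phi>" for \<phi>
  proof -
    let ?s = "\<Sum>i=1..n. scale (d i) ((pmap ^^ i) x)"
    have "\<phi> (x - ?s) = 0"
      using character_p_nilpotent[OF \<phi>] nd unfolding p_nilpotents_def by simp
    moreover have "\<phi> ((x - ?s) + ?s) = \<phi> (x - ?s) + \<phi> ?s"
      using \<phi> unfolding character_def by blast
    ultimately have "\<phi> x = \<phi> ?s" by simp
    hence x: "\<phi> x = (\<Sum>i=1..n. to_ac (d i) * \<phi> x ^ (CHAR('k) ^ i))"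
      by (simp only: character_sum[OF \<phi>] character_funpow_pmap[OF \<phi>])
    have e: "free_eval \<phi> e = (\<Sum>i=1..n. to_ac (d i) * \<phi> x ^ (CHAR('k) ^ i - 1))"
      unfolding e_def by (simp add: free_eval_sum)
    show ?thesis
    proof (cases "\<phi> x = 0")
      case True
      have gt: "CHAR('k) ^ i > 1" if "i \<in> {1..n}" for i
        using that prime_gt_1_nat[OF prime_char] by (intro one_less_power) auto
      have "\<phi> x ^ (CHAR('k) ^ i - 1) = 0" if "i \<in> {1..n}" for i
        using gt[OF that] True by (simp add: power_0_left)
      hence "free_eval \<phi> e = 0"
        unfolding e by (intro sum.neutral ballI) (simp only: mult_zero_right)
      thus ?thesis using True by simp
    next
      case False
      have "free_eval \<phi> e * \<phi> x = \<phi> x"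
        unfolding e sum_distrib_right
      proof (subst (3) x, intro sum.cong refl)
        fix i
        have "CHAR('k) ^ i > 0" using char_pos by simp
        thus "to_ac (d i) * \<phi> x ^ (CHAR('k) ^ i - 1) * \<phi> x = to_ac (d i) * \<phi> x ^ (CHAR('k) ^ i)"
          by (simp add: mult.assoc flip: power_Suc2)
      qed
      thus ?thesis using False by simp
    qed
  qed
  thus ?thesis by (rule that)
qed

lemma abelian_quotient_hull_plus:
  assumes P: "abelian_quotient P"
  shows "abelian_quotient {t + u | t u. t \<in> restricted_subalgebra hull A \<and> u \<in> P}"
    (is "abelian_quotient ?V")
proof -
  let ?T = "restricted_subalgebra hull A"
  have T: "subspace ?T" "\<And>t. t \<in> ?T \<Longrightarrow> pmap t \<in> ?T"
    using restricted_subalgebra_hull[of A] unfolding restricted_subalgebra_def by auto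
  have sub: "subspace P" and PF: "\<And>u. u \<in> P \<Longrightarrow> pmap u \<in> P" and br: "\<And>x y. bracket x y \<in> P"
    using P unfolding abelian_quotient_def by auto
  have I: "t + u \<in> ?V" if "t \<in> ?T" "u \<in> P" for t u using that by blast
  have "subspace ?V"
    using subspace_sums[OF T(1) sub] by (simp add: conj_commute)
  moreover have "bracket x y \<in> ?V" for x y
    using I[OF subspace_0[OF T(1)] br] by simp
  moreover have "pmap v \<in> ?V" if v: "v \<in> ?V" for v
  proof -
    from v obtain t u where tu: "v = t + u" "t \<in> ?T" "u \<in> P" by auto
    have "(pmap (t + u) - (pmap t + pmap u)) + pmap u \<in> P"
      using pmap_add_mod_abelian[OF P] PF[OF tu(3)] by (intro subspace_add[OF sub]) auto
    from I[OF T(2)[OF tu(2)] this] show ?thesis unfolding tu(1) by (simp add: algebra_simps)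
  qed
  ultimately show ?thesis unfolding abelian_quotient_def by blast
qed

text \<open>
  Were the codimension infinite, one could choose elements \<open>x\<^sub>n\<close> none of which lies in the sum of the
  \<open>p\<close>-nilpotent elements and the restricted subalgebra generated by its predecessors. Let \<open>A\<^sub>n\<close> be the
  intersection of the kernels of all characters that do not vanish on all of \<open>x\<^sub>0, \<dots>, x\<^sub>n\<close>. These left
  ideals decrease strictly: the product of the elements \<open>1 - e\<^sub>j\<close> for \<open>j \<le> n\<close>, with \<open>e\<^sub>j\<close> the support idempotent
  of \<open>x\<^sub>j\<close>, lies in \<open>A\<^sub>n\<close>, whereas a character that vanishes on \<open>x\<^sub>0, \<dots>, x\<^sub>n\<close> but not on
  \<open>x\<^sub>n\<^sub>+\<^sub>1\<close> maps it to \<open>1\<close>. Since kernels of characters are maximal left ideals, this contradicts the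
  Artinian condition.
\<close>

theorem finite_codimension_p_nilpotents:
  assumes root: "\<And>a :: 'k. \<exists>b. b ^ CHAR('k) = a"
    and lf: locally_finite_dimensional
    and nil: "p_nil derived_subalgebra"
    and art: "left_artinian (restricted_enveloping_algebra Quot
      jacobson_radical restricted_enveloping_algebra)"
  shows "finite_codimension p_nilpotents"
proof (rule ccontr)
  assume inf: "\<not> finite_codimension p_nilpotents"
  let ?R = "ring_of_type_algebra :: ('l free_word \<Rightarrow>\<^sub>0 'k) ring"
  let ?I = "genideal ?R enveloping_relations"
  interpret R: ring ?R by (rule ring_ring_of_type_algebra)
  interpret I: ideal ?I ?R by (rule R.genideal_ideal) simp
  have "bracket x y \<in> derived_subalgebra" for x y
    unfolding derived_subalgebra_def by (auto intro: span_base)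
  hence P: "abelian_quotient p_nilpotents"
    using restricted_ideal_p_nilpotents[OF lf nil] nil
    unfolding abelian_quotient_def restricted_ideal_def p_nil_def p_nilpotents_def by blast
  have rad: "pmap_radical p_nilpotents"
    unfolding pmap_radical_def p_nilpotents_def by (simp add: p_nilpotent_iff_pmap)
  define V where "V A = {t + u | t u. t \<in> restricted_subalgebra hull A \<and> u \<in> p_nilpotents}" for A
  have V: "abelian_quotient (V A)" for A
    unfolding V_def by (rule abelian_quotient_hull_plus[OF P])
  have "0 \<in> restricted_subalgebra hull A" for A
    using restricted_subalgebra_hull[of A] unfolding restricted_subalgebra_def
    by (intro subspace_0) blast
  hence PV: "p_nilpotents \<subseteq> V A" for A
    unfolding V_def by (force intro: exI[of _ 0])
  have radV: "pmap_radical (V A)" for A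
    by (rule pmap_radical_mono[OF root lf P rad V PV])
  have AV: "A \<subseteq> V A" for A
  proof
    fix x assume "x \<in> A"
    hence "x \<in> restricted_subalgebra hull A" by (rule hull_inc)
    moreover have "0 \<in> p_nilpotents"
      using P unfolding abelian_quotient_def by (intro subspace_0) blast
    ultimately show "x \<in> V A"
      unfolding V_def by (intro CollectI exI[of _ x] exI[of _ 0]) simp
  qed
  have ex: "\<exists>x. x \<notin> V A" if "finite A" for A
  proof (rule ccontr)
    assume "\<not> ?thesis"
    hence all: "x \<in> V A" for x by blast
    obtain B where B: "finite B" "span B = restricted_subalgebra hull A"
      using lf \<open>finite A\<close> unfolding locally_finite_dimensional_def finite_dimensional_def by blast
    have "\<exists>y\<in>span B. x - y \<in> p_nilpotents" for x
    proof -
      obtain t u where "x = t + u" "t \<in> restricted_subalgebra hull A" "u \<in> p_nilpotents"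
        using all[of x] unfolding V_def by blast
      thus ?thesis unfolding B(2) by (intro bexI[of _ t]) auto
    qed
    hence "finite_codimension p_nilpotents"
      using B(1) P unfolding finite_codimension_def abelian_quotient_def by blast
    thus False using inf by simp
  qed
  have "\<exists>f. \<forall>n::nat. f n \<notin> V (f ` {..<n})"
  proof (rule dependent_wellorder_choice)
    show "(r \<notin> V (f ` {..<n})) = (r \<notin> V (g ` {..<n}))" if "\<And>m. m < n \<Longrightarrow> f m = g m" for r f g n
      using that by (metis image_cong lessThan_iff)
  qed (use ex in auto)
  then obtain x where "\<forall>n::nat. x n \<notin> V (x ` {..<n})"
    by (rule exE)
  hence x: "x n \<notin> V (x ` {..<n})" for n :: nat
    by (rule spec)
  define Ker where "Ker \<phi> = {f :: 'l free_word \<Rightarrow>\<^sub>0 'k. free_eval \<phi> f = 0}" for \<phi>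
  define M where "M n = Ker ` {\<phi>. character \<phi> \<and> (\<exists>j\<le>n. \<phi> (x j) \<noteq> 0)}" for n :: nat
  have "\<exists>N. \<forall>n\<ge>N. carrier ?R \<inter> \<Inter>(M n) = carrier ?R \<inter> \<Inter>(M N)"
  proof (rule I.left_artinian_radical_quotient_chain)
    show "left_artinian (?R Quot ?I Quot jacobson_radical (?R Quot ?I))"
      using art unfolding restricted_enveloping_algebra_def .
    show "maximal_left_ideal N ?R \<and> ?I \<subseteq> N" if "N \<in> M n" for n N
      using that maximal_left_ideal_free_eval_kernel enveloping_ideal_subset_kernel
      unfolding M_def Ker_def by blast
    show "M n \<subseteq> M (Suc n)" for n
      unfolding M_def using le_SucI by blast
  qed
  then obtain N where N: "\<Inter>(M (Suc N)) = \<Inter>(M N)"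
    by (metis Int_UNIV_left le_SucI order.refl ring_of_type_algebra_simps(1))
  have "\<exists>r :: 'l free_word \<Rightarrow>\<^sub>0 'k. \<forall>\<phi>. character \<phi> \<longrightarrow>
      free_eval \<phi> r = (if \<exists>j<n. \<phi> (x j) \<noteq> 0 then 0 else 1)" for n
  proof (induction n)
    case 0
    show ?case by (intro exI[of _ 1]) simp
  next
    case (Suc n)
    then obtain r :: "'l free_word \<Rightarrow>\<^sub>0 'k" where r: "\<And>\<phi>. character \<phi> \<Longrightarrow>
      free_eval \<phi> r = (if \<exists>j<n. \<phi> (x j) \<noteq> 0 then 0 else 1)" by blast
    obtain e :: "'l free_word \<Rightarrow>\<^sub>0 'k"
      where e: "\<And>\<phi>. character \<phi> \<Longrightarrow> free_eval \<phi> e = (if \<phi> (x n) = 0 then 0 else 1)"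
      by (rule exists_support_idempotent[OF root lf P rad]) blast
    show ?case
      by (intro exI[of _ "r * (1 - e)"]) (auto simp: r e less_Suc_eq)
  qed
  then obtain r :: "'l free_word \<Rightarrow>\<^sub>0 'k" where r: "\<And>\<phi>. character \<phi> \<Longrightarrow>
    free_eval \<phi> r = (if \<exists>j<Suc N. \<phi> (x j) \<noteq> 0 then 0 else 1)" by blast
  have "r \<in> \<Inter>(M N)"
    unfolding M_def Ker_def by (auto simp: r less_Suc_eq_le)
  moreover have "r \<notin> \<Inter>(M (Suc N))"
  proof -
    obtain \<phi> where \<phi>: "character \<phi>" "\<And>v. v \<in> V (x ` {..<Suc N}) \<Longrightarrow> \<phi> v = 0" "\<phi> (x (Suc N)) \<noteq> 0"
      by (rule exists_character[OF lf V radV x]) blast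
    have "\<phi> (x j) = 0" if "j < Suc N" for j
      using that AV[of "x ` {..<Suc N}"] by (intro \<phi>(2)) blast
    hence "free_eval \<phi> r = 1" using r[OF \<phi>(1)] by auto
    hence "r \<notin> Ker \<phi>" unfolding Ker_def by simp
    moreover have "Ker \<phi> \<in> M (Suc N)" unfolding M_def using \<phi>(1,3) by blast
    ultimately show ?thesis by blast
  qed
  ultimately show False using N by simp
qed

lemma finite_codimension_mono:
  assumes "finite_codimension S" "S \<subseteq> T" "subspace T"
  shows "finite_codimension T"
proof -
  obtain B where B: "finite B" "\<And>x. \<exists>y\<in>span B. x - y \<in> S"
    using assms(1) unfolding finite_codimension_def by auto
  have "\<exists>y\<in>span B. x - y \<in> T" for x
    using B(2)[of x] assms(2) by (meson subsetD)
  thus ?thesis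
    using B(1) assms(3) unfolding finite_codimension_def by auto
qed

end

theorem proposition2p8:
  fixes scale :: "'k::field \<Rightarrow> 'l::ab_group_add \<Rightarrow> 'l"
    and bracket :: "'l \<Rightarrow> 'l \<Rightarrow> 'l"
    and pmap :: "'l \<Rightarrow> 'l"
  assumes "CHAR('k) > 0"
    and "perfect_field TYPE('k)"
    and "restricted_lie_algebra scale bracket pmap"
    and "restricted_lie_algebra.locally_finite_dimensional scale bracket pmap"
    and "semiperfect (restricted_lie_algebra.restricted_enveloping_algebra scale bracket pmap)"
    and "restricted_lie_algebra.p_nil pmap (lie_algebra.derived_subalgebra scale bracket)"
  shows "restricted_lie_algebra.finite_codimension scale
           (restricted_lie_algebra.O_p scale bracket pmap)"
proof -
  interpret restricted_lie_algebra scale bracket pmap by (rule assms(3))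
  have "finite_codimension p_nilpotents"
    using assms(5) unfolding semiperfect_def artinian_def
    by (intro finite_codimension_p_nilpotents perfect_field_pth_root assms) blast
  moreover have "p_nilpotents \<subseteq> O_p"
    by (intro p_nilpotents_subset_O_p restricted_ideal_p_nilpotents assms)
  ultimately show ?thesis
    by (rule finite_codimension_mono) (simp add: O_p_def subspace_span)
qed

end
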